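(* (A) Every restriction semigroup has an almost perfect (projection-separating) cover. Moreover, for every monoid $T$, every semilattice $Y$ and every monoidal homomorphism $T\to TI_Y$, the semigroup $W(T,Y)$ is an almost perfect restriction semigroup; conversely, every almost perfect restriction semigroup $S$ is isomorphic (as a restriction semigroup) to a semigroup of that form. (B) Every restriction monoid has a perfect monoidal cover. If $T$ is a monoid acting by isomorphisms between principal ideals of a semilattice $Y$ with identity (that is, the monoidal homomorphism $T\to TI_Y$ takes its values in $T_Y$), then $W(T,Y)$ is a perfect restriction monoid; conversely, every perfect restriction monoid $M$ is isomorphic to such a monoid $W(T,Y)$, where $Y=P_M$ is the semilattice of projections of $M$, $T=M/\sigma$, and the action of $T$ on $Y$ is induced by the Munn representation $\theta$ of $M$, that is, it is given by the map $T\to T_Y$, $a\sigma\mapsto\theta_{m_a}$, where $m_a$ is the greatest element of the $\sigma$-class of $a$.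
   Context: A restriction semigroup is an algebra $(S,\cdot,{}^+,{}^* )$ with $(S,\cdot)$ a semigroup, satisfying $x^+x=x$, $(x^+y)^+=x^+y^+$, $x^+y^+=y^+x^+$, $xy^+=(xy)^+x$, the dual identities $xx^*=x$, $(yx^* )^*=y^*x^*$, $y^*x^*=x^*y^*$, $y^*x=x(yx)^*$, and $(x^+)^*=x^+$, $(x^* )^+=x^*$. Its projections form the semilattice $P_S=\{x^+:x\in S\}=\{x^*:x\in S\}$. A restriction monoid is a restriction semigroup with identity $1$ (so $1^+=1^*=1$). A plain monoid is regarded as a restriction monoid by setting $a^+=a^*=1$ for all $a$. Homomorphisms and isomorphisms of restriction semigroups respect all three operations; 'monoidal' means also preserving identities. The natural partial order is $a\le b$ iff $a=eb$ for some $e\in P_S$. Relations on $S$: $a\mathrel{\mathbb R}b$ iff $a^+=b^+$; $a\mathrel{\mathbb L}b$ iff $a^*=b^*$; $\sigma=\{(a,b): ea=eb\text{ for some }e\in P_S\}$ is the least congruence identifying all projections (the least monoid congruence). $S$ is proper if $\mathbb R\cap\sigma$ and $\mathbb L\cap\sigma$ are both the identity relation. A congruence $\rho$ is perfect if $(a\rho)(b\rho)=(ab)\rho$ for all $a,b$ (product of subsets). $S$ is almost perfect if it is proper and $\sigma$ is perfect. A restriction monoid is perfect if it is proper, $\sigma$ is perfect, and every $\sigma$-class has a greatest element. A homomorphism is projection-separating ($P$-separating) if it is injective on projections. A cover of a restriction semigroup $U$ is a proper restriction semigroup $S$ having $U$ as the image of a $P$-separating homomorphism; a monoidal cover of a restriction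 monoid is a restriction monoid which is a cover via a monoidal homomorphism. For a semilattice $Y$, ideals are nonempty subsets closed downwards. $TI_Y$ is the inverse monoid of all isomorphisms between ideals of $Y$, under composition of partial maps (written on the right, composed left to right), and $T_Y$ is its inverse subsemigroup of isomorphisms between principal ideals (the Munn semigroup). Given a monoidal homomorphism $\alpha:T\to TI_Y$, write $\Delta t$, $\nabla t$ for the domain and range of $t\alpha$ and $e^t=e(t\alpha)$ for $e\in\Delta t$; one says $T$ acts on $Y$ by isomorphisms between ideals. Then $$W(T,Y)=\{(t,e^t)\in T\times Y: e\in\Delta t\}=\{(t,f)\in T\times Y: f\in\nabla t\},$$ with $(t,e^t)(u,f^u)=(tu,(e^tf)^u)$, $(t,e^t)^+=(1,e)$, $(t,f)^*=(1,f)$. The (generalized) Munn representation of a restriction semigroup $S$ is $\theta:S\to T_{P_S}$, $a\mapsto\theta_a$, where $\theta_a$ has domain $\{e\in P_S:e\le a^+\}$ and $e\theta_a=(ea)^*$. *)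

theory Defs
  imports "HOL-Algebra.Group"
begin

section \<open>Semigroups with identity, semilattices\<close>

record 'a magma = "'a partial_object" +
  smult :: "'a \<Rightarrow> 'a \<Rightarrow> 'a"  (infixl \<open>\<cdot>\<index>\<close> 70)

definition is_identity :: "('a, 'm) magma_scheme \<Rightarrow> 'a \<Rightarrow> bool" where
  "is_identity X e \<longleftrightarrow> e \<in> carrier X \<and> (\<forall>x\<in>carrier X. e \<cdot>\<^bsub>X\<^esub> x = x \<and> x \<cdot>\<^bsub>X\<^esub> e = x)"

definition has_identity :: "('a, 'm) magma_scheme \<Rightarrow> bool" where
  "has_identity X \<longleftrightarrow> (\<exists>e. is_identity X e)"

locale semilattice_algebra =
  fixes Y :: "('a, 'm) magma_scheme" (structure)
  assumes nonempty: "carrier Y \<noteq> {}"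
    and closed: "\<lbrakk>e \<in> carrier Y; f \<in> carrier Y\<rbrakk> \<Longrightarrow> e \<cdot> f \<in> carrier Y"
    and assoc: "\<lbrakk>e \<in> carrier Y; f \<in> carrier Y; g \<in> carrier Y\<rbrakk> \<Longrightarrow> (e \<cdot> f) \<cdot> g = e \<cdot> (f \<cdot> g)"
    and comm: "\<lbrakk>e \<in> carrier Y; f \<in> carrier Y\<rbrakk> \<Longrightarrow> e \<cdot> f = f \<cdot> e"
    and idem: "e \<in> carrier Y \<Longrightarrow> e \<cdot> e = e"


section \<open>Restriction semigroups\<close>

text \<open>The components \<open>rplus S x\<close> and \<open>rstar S x\<close> are \<open>x\<^sup>+\<close> and \<open>x\<^sup>*\<close>.\<close>

record 'a restr = "'a magma" +
  rplus :: "'a \<Rightarrow> 'a"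
  rstar :: "'a \<Rightarrow> 'a"

locale restriction_semigroup =
  fixes S :: "('a, 'm) restr_scheme" (structure)
  assumes nonempty: "carrier S \<noteq> {}"
    and closed: "\<lbrakk>x \<in> carrier S; y \<in> carrier S\<rbrakk> \<Longrightarrow> x \<cdot> y \<in> carrier S"
    and plus_closed: "x \<in> carrier S \<Longrightarrow> rplus S x \<in> carrier S"
    and star_closed: "x \<in> carrier S \<Longrightarrow> rstar S x \<in> carrier S"
    and assoc: "\<lbrakk>x \<in> carrier S; y \<in> carrier S; z \<in> carrier S\<rbrakk> \<Longrightarrow> (x \<cdot> y) \<cdot> z = x \<cdot> (y \<cdot> z)"
    and plus_left: "x \<in> carrier S \<Longrightarrow> rplus S x \<cdot> x = x"
    and plus_plus: "\<lbrakk>x \<in> carrier S; y \<in> carrier S\<rbrakk> \<Longrightarrow>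
      rplus S (rplus S x \<cdot> y) = rplus S x \<cdot> rplus S y"
    and plus_comm: "\<lbrakk>x \<in> carrier S; y \<in> carrier S\<rbrakk> \<Longrightarrow>
      rplus S x \<cdot> rplus S y = rplus S y \<cdot> rplus S x"
    and plus_ample: "\<lbrakk>x \<in> carrier S; y \<in> carrier S\<rbrakk> \<Longrightarrow> x \<cdot> rplus S y = rplus S (x \<cdot> y) \<cdot> x"
    and star_right: "x \<in> carrier S \<Longrightarrow> x \<cdot> rstar S x = x"
    and star_star: "\<lbrakk>x \<in> carrier S; y \<in> carrier S\<rbrakk> \<Longrightarrow>
      rstar S (y \<cdot> rstar S x) = rstar S y \<cdot> rstar S x"
    and star_comm: "\<lbrakk>x \<in> carrier S; y \<in> carrier S\<rbrakk> \<Longrightarrow>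
      rstar S y \<cdot> rstar S x = rstar S x \<cdot> rstar S y"
    and star_ample: "\<lbrakk>x \<in> carrier S; y \<in> carrier S\<rbrakk> \<Longrightarrow> rstar S y \<cdot> x = x \<cdot> rstar S (y \<cdot> x)"
    and star_of_plus: "x \<in> carrier S \<Longrightarrow> rstar S (rplus S x) = rplus S x"
    and plus_of_star: "x \<in> carrier S \<Longrightarrow> rplus S (rstar S x) = rstar S x"

definition restriction_monoid :: "('a, 'm) restr_scheme \<Rightarrow> bool" where
  "restriction_monoid S \<longleftrightarrow> restriction_semigroup S \<and> has_identity S"

definition proj :: "('a, 'm) restr_scheme \<Rightarrow> 'a set" where
  "proj S = rplus S ` carrier S"

definition proj_semilattice :: "('a, 'm) restr_scheme \<Rightarrow> 'a magma" where
  "proj_semilattice S = \<lparr>carrier = proj S, smult = smult S\<rparr>"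

definition natural_le :: "('a, 'm) restr_scheme \<Rightarrow> 'a \<Rightarrow> 'a \<Rightarrow> bool" where
  "natural_le S a b \<longleftrightarrow> (\<exists>e\<in>proj S. a = e \<cdot>\<^bsub>S\<^esub> b)"

definition R_rel :: "('a, 'm) restr_scheme \<Rightarrow> ('a \<times> 'a) set" where
  "R_rel S = {(a, b). a \<in> carrier S \<and> b \<in> carrier S \<and> rplus S a = rplus S b}"

definition L_rel :: "('a, 'm) restr_scheme \<Rightarrow> ('a \<times> 'a) set" where
  "L_rel S = {(a, b). a \<in> carrier S \<and> b \<in> carrier S \<and> rstar S a = rstar S b}"

definition sigma :: "('a, 'm) restr_scheme \<Rightarrow> ('a \<times> 'a) set" where
  "sigma S = {(a, b). a \<in> carrier S \<and> b \<in> carrier S \<and>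
     (\<exists>e\<in>proj S. e \<cdot>\<^bsub>S\<^esub> a = e \<cdot>\<^bsub>S\<^esub> b)}"

definition congruence :: "('a, 'm) restr_scheme \<Rightarrow> ('a \<times> 'a) set \<Rightarrow> bool" where
  "congruence S \<rho> \<longleftrightarrow> equiv (carrier S) \<rho> \<and>
     (\<forall>(a, a')\<in>\<rho>. \<forall>(b, b')\<in>\<rho>. (a \<cdot>\<^bsub>S\<^esub> b, a' \<cdot>\<^bsub>S\<^esub> b') \<in> \<rho>) \<and>
     (\<forall>(a, a')\<in>\<rho>. (rplus S a, rplus S a') \<in> \<rho> \<and> (rstar S a, rstar S a') \<in> \<rho>)"

definition perfect_congruence :: "('a, 'm) restr_scheme \<Rightarrow> ('a \<times> 'a) set \<Rightarrow> bool" where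
  "perfect_congruence S \<rho> \<longleftrightarrow> congruence S \<rho> \<and>
     (\<forall>a\<in>carrier S. \<forall>b\<in>carrier S.
        {x \<cdot>\<^bsub>S\<^esub> y |x y. x \<in> \<rho> `` {a} \<and> y \<in> \<rho> `` {b}} = \<rho> `` {a \<cdot>\<^bsub>S\<^esub> b})"

definition proper :: "('a, 'm) restr_scheme \<Rightarrow> bool" where
  "proper S \<longleftrightarrow> restriction_semigroup S \<and>
     R_rel S \<inter> sigma S = Id_on (carrier S) \<and> L_rel S \<inter> sigma S = Id_on (carrier S)"

definition almost_perfect :: "('a, 'm) restr_scheme \<Rightarrow> bool" where
  "almost_perfect S \<longleftrightarrow> proper S \<and> perfect_congruence S (sigma S)"

definition is_greatest :: "('a, 'm) restr_scheme \<Rightarrow> 'a set \<Rightarrow> 'a \<Rightarrow> bool" where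
  "is_greatest S C m \<longleftrightarrow> m \<in> C \<and> (\<forall>a\<in>C. natural_le S a m)"

definition greatest_of :: "('a, 'm) restr_scheme \<Rightarrow> 'a set \<Rightarrow> 'a" where
  "greatest_of S C = (THE m. is_greatest S C m)"

definition perfect :: "('a, 'm) restr_scheme \<Rightarrow> bool" where
  "perfect S \<longleftrightarrow> restriction_monoid S \<and> proper S \<and> perfect_congruence S (sigma S) \<and>
     (\<forall>C\<in>carrier S // sigma S. \<exists>m. is_greatest S C m)"


section \<open>Homomorphisms, covers and the quotient by \<open>\<sigma>\<close>\<close>

definition restr_hom :: "('a, 'm) restr_scheme \<Rightarrow> ('b, 'n) restr_scheme \<Rightarrow> ('a \<Rightarrow> 'b) set" where
  "restr_hom S U = {h. h \<in> carrier S \<rightarrow> carrier U \<and>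
     (\<forall>x\<in>carrier S. \<forall>y\<in>carrier S. h (x \<cdot>\<^bsub>S\<^esub> y) = h x \<cdot>\<^bsub>U\<^esub> h y) \<and>
     (\<forall>x\<in>carrier S. h (rplus S x) = rplus U (h x) \<and> h (rstar S x) = rstar U (h x))}"

definition restr_iso :: "('a, 'm) restr_scheme \<Rightarrow> ('b, 'n) restr_scheme \<Rightarrow> bool" where
  "restr_iso S U \<longleftrightarrow> (\<exists>h\<in>restr_hom S U. bij_betw h (carrier S) (carrier U))"

definition preserves_identity ::
    "('a, 'm) restr_scheme \<Rightarrow> ('b, 'n) restr_scheme \<Rightarrow> ('a \<Rightarrow> 'b) \<Rightarrow> bool" where
  "preserves_identity S U h \<longleftrightarrow> (\<forall>e. is_identity S e \<longrightarrow> is_identity U (h e))"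

definition covers_via ::
    "('a, 'm) restr_scheme \<Rightarrow> ('b, 'n) restr_scheme \<Rightarrow> ('a \<Rightarrow> 'b) \<Rightarrow> bool" where
  "covers_via S U h \<longleftrightarrow> proper S \<and> h \<in> restr_hom S U \<and>
     inj_on h (proj S) \<and> h ` carrier S = carrier U"

definition is_cover :: "('a, 'm) restr_scheme \<Rightarrow> ('b, 'n) restr_scheme \<Rightarrow> bool" where
  "is_cover S U \<longleftrightarrow> (\<exists>h. covers_via S U h)"

definition is_monoidal_cover :: "('a, 'm) restr_scheme \<Rightarrow> ('b, 'n) restr_scheme \<Rightarrow> bool" where
  "is_monoidal_cover S U \<longleftrightarrow> restriction_monoid S \<and> restriction_monoid U \<and>
     (\<exists>h. covers_via S U h \<and> preserves_identity S U h)"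

text \<open>
  The monoid \<open>S/\<sigma>\<close>. The product of two classes is the class containing all products of their
  members, which is obtained by saturating the set of these products; the identity is the class
  containing all projections.
\<close>

definition sigma_quotient :: "('a, 'm) restr_scheme \<Rightarrow> 'a set monoid" where
  "sigma_quotient S =
     \<lparr>carrier = carrier S // sigma S,
      monoid.mult = (\<lambda>A B. sigma S `` {a \<cdot>\<^bsub>S\<^esub> b |a b. a \<in> A \<and> b \<in> B}),
      one = sigma S `` proj S\<rparr>"


section \<open>Partial isomorphisms of a semilattice\<close>

definition down :: "('y, 'm) magma_scheme \<Rightarrow> 'y \<Rightarrow> 'y set" where
  "down Y e = {f \<in> carrier Y. f = f \<cdot>\<^bsub>Y\<^esub> e}"

definition is_ideal :: "('y, 'm) magma_scheme \<Rightarrow> 'y set \<Rightarrow> bool" where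
  "is_ideal Y I \<longleftrightarrow> I \<noteq> {} \<and> I \<subseteq> carrier Y \<and> (\<forall>e\<in>I. down Y e \<subseteq> I)"

definition is_principal_ideal :: "('y, 'm) magma_scheme \<Rightarrow> 'y set \<Rightarrow> bool" where
  "is_principal_ideal Y I \<longleftrightarrow> (\<exists>e\<in>carrier Y. I = down Y e)"

text \<open>
  Partial maps act on the right and are composed from left to right, so the product of \<open>\<alpha>\<close> and
  \<open>\<beta>\<close> in \<open>TI Y\<close> is ``first \<open>\<alpha>\<close>, then \<open>\<beta>\<close>''.
\<close>

definition TI :: "('y, 'm) magma_scheme \<Rightarrow> ('y \<rightharpoonup> 'y) monoid" where
  "TI Y =
     \<lparr>carrier = {\<alpha>. is_ideal Y (dom \<alpha>) \<and> is_ideal Y (ran \<alpha>) \<and> inj_on \<alpha> (dom \<alpha>) \<and>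
        (\<forall>e\<in>dom \<alpha>. \<forall>f\<in>dom \<alpha>. \<alpha> (e \<cdot>\<^bsub>Y\<^esub> f) = Some (the (\<alpha> e) \<cdot>\<^bsub>Y\<^esub> the (\<alpha> f)))},
      monoid.mult = (\<lambda>\<alpha> \<beta>. \<beta> \<circ>\<^sub>m \<alpha>),
      one = (\<lambda>e. if e \<in> carrier Y then Some e else None)\<rparr>"

definition munn_semigroup :: "('y, 'm) magma_scheme \<Rightarrow> ('y \<rightharpoonup> 'y) set" where
  "munn_semigroup Y =
     {\<alpha> \<in> carrier (TI Y). is_principal_ideal Y (dom \<alpha>) \<and> is_principal_ideal Y (ran \<alpha>)}"

definition acts_by_ideal_isos ::
    "('t, 'n) monoid_scheme \<Rightarrow> ('y, 'm) magma_scheme \<Rightarrow> ('t \<Rightarrow> 'y \<rightharpoonup> 'y) \<Rightarrow> bool" where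
  "acts_by_ideal_isos T Y \<alpha> \<longleftrightarrow> \<alpha> \<in> hom T (TI Y) \<and> \<alpha> \<one>\<^bsub>T\<^esub> = \<one>\<^bsub>TI Y\<^esub>"

definition acts_by_principal_ideal_isos ::
    "('t, 'n) monoid_scheme \<Rightarrow> ('y, 'm) magma_scheme \<Rightarrow> ('t \<Rightarrow> 'y \<rightharpoonup> 'y) \<Rightarrow> bool" where
  "acts_by_principal_ideal_isos T Y \<alpha> \<longleftrightarrow>
     acts_by_ideal_isos T Y \<alpha> \<and> \<alpha> \<in> carrier T \<rightarrow> munn_semigroup Y"


section \<open>The semigroup \<open>W(T,Y)\<close>\<close>

text \<open>
  \<open>act \<alpha> t e\<close> is \<open>e\<^sup>t\<close>, for \<open>e\<close> in the domain of \<open>\<alpha> t\<close>, and \<open>unact \<alpha> t f\<close> is the unique \<open>e\<close> with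
  \<open>e\<^sup>t = f\<close>, for \<open>f\<close> in the range of \<open>\<alpha> t\<close>. The operations of \<open>W(T,Y)\<close> are written on pairs
  \<open>(t, f)\<close> with \<open>f\<close> in the range of \<open>\<alpha> t\<close>; the lemmas below give them on pairs \<open>(t, e\<^sup>t)\<close>.
\<close>

definition act :: "('t \<Rightarrow> 'y \<rightharpoonup> 'y) \<Rightarrow> 't \<Rightarrow> 'y \<Rightarrow> 'y" where
  "act \<alpha> t e = the (\<alpha> t e)"

definition unact :: "('t \<Rightarrow> 'y \<rightharpoonup> 'y) \<Rightarrow> 't \<Rightarrow> 'y \<Rightarrow> 'y" where
  "unact \<alpha> t f = (THE e. \<alpha> t e = Some f)"

definition W ::
    "('t, 'n) monoid_scheme \<Rightarrow> ('y, 'm) magma_scheme \<Rightarrow> ('t \<Rightarrow> 'y \<rightharpoonup> 'y) \<Rightarrow> ('t \<times> 'y) restr" where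
  "W T Y \<alpha> =
     \<lparr>carrier = {(t, act \<alpha> t e) |t e. t \<in> carrier T \<and> e \<in> dom (\<alpha> t)},
      smult = (\<lambda>(t, g) (u, h). (t \<otimes>\<^bsub>T\<^esub> u, act \<alpha> u (g \<cdot>\<^bsub>Y\<^esub> unact \<alpha> u h))),
      rplus = (\<lambda>(t, g). (\<one>\<^bsub>T\<^esub>, unact \<alpha> t g)),
      rstar = (\<lambda>(t, g). (\<one>\<^bsub>T\<^esub>, g))\<rparr>"

lemma carrier_W: "carrier (W T Y \<alpha>) = {(t, f). t \<in> carrier T \<and> f \<in> ran (\<alpha> t)}"
proof -
  have "(\<exists>e. f = act \<alpha> t e \<and> e \<in> dom (\<alpha> t)) \<longleftrightarrow> f \<in> ran (\<alpha> t)" for t f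
    unfolding act_def ran_def dom_def by (auto; metis option.sel)
  then show ?thesis unfolding W_def by auto
qed

lemma unact_act:
  assumes "acts_by_ideal_isos T Y \<alpha>" "t \<in> carrier T" "e \<in> dom (\<alpha> t)"
  shows "unact \<alpha> t (act \<alpha> t e) = e"
proof -
  have inj: "inj_on (\<alpha> t) (dom (\<alpha> t))"
    using assms(1,2) by (auto simp: acts_by_ideal_isos_def hom_def TI_def)
  obtain f where f: "\<alpha> t e = Some f" using assms(3) by auto
  have "e' = e" if "\<alpha> t e' = Some f" for e'
  proof (rule inj_onD[OF inj])
    show "\<alpha> t e' = \<alpha> t e" using f that by simp
    show "e' \<in> dom (\<alpha> t)" using that by (rule domI)
    show "e \<in> dom (\<alpha> t)" by (rule assms(3))
  qed
  with f have "(THE e'. \<alpha> t e' = Some f) = e" by (rule the_equality)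
  with f show ?thesis by (simp add: unact_def act_def)
qed

lemma W_mult:
  assumes "acts_by_ideal_isos T Y \<alpha>" "u \<in> carrier T" "f \<in> dom (\<alpha> u)"
  shows "(t, act \<alpha> t e) \<cdot>\<^bsub>W T Y \<alpha>\<^esub> (u, act \<alpha> u f) =
     (t \<otimes>\<^bsub>T\<^esub> u, act \<alpha> u (act \<alpha> t e \<cdot>\<^bsub>Y\<^esub> f))"
  using unact_act[OF assms] by (simp add: W_def)

lemma W_plus:
  assumes "acts_by_ideal_isos T Y \<alpha>" "t \<in> carrier T" "e \<in> dom (\<alpha> t)"
  shows "rplus (W T Y \<alpha>) (t, act \<alpha> t e) = (\<one>\<^bsub>T\<^esub>, e)"
  using unact_act[OF assms] by (simp add: W_def)

lemma W_star: "rstar (W T Y \<alpha>) (t, f) = (\<one>\<^bsub>T\<^esub>, f)"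
  by (simp add: W_def)


section \<open>The Munn representation\<close>

definition munn :: "('a, 'm) restr_scheme \<Rightarrow> 'a \<Rightarrow> ('a \<rightharpoonup> 'a)" where
  "munn S a = (\<lambda>e. if e \<in> proj S \<and> natural_le S e (rplus S a)
                   then Some (rstar S (e \<cdot>\<^bsub>S\<^esub> a)) else None)"

text \<open>The map \<open>a\<sigma> \<mapsto> \<theta>\<close> at \<open>m\<^sub>a\<close>, where \<open>m\<^sub>a\<close> is the greatest element of the class \<open>a\<sigma>\<close>.\<close>

definition munn_action :: "('a, 'm) restr_scheme \<Rightarrow> 'a set \<Rightarrow> ('a \<rightharpoonup> 'a)" where
  "munn_action M C = munn M (greatest_of M C)"

end

theory Submission
  imports Defs
begin

text \<open>
  The cover of \<open>S\<close> is \<open>W(S\<^sup>*,P\<^sub>S)\<close>, where the free monoid \<open>S\<^sup>*\<close> of words over \<open>S\<close> acts by composites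
  of the Munn isomorphisms \<open>\<theta>\<^sub>a\<close>; a pair \<open>(a\<^sub>1\<dots>a\<^sub>n, f)\<close> is mapped to \<open>a\<^sub>1\<cdots>a\<^sub>n f\<close>. If \<open>S\<close> has an
  identity, the action has values in \<open>T\<^sub>Y\<close>, because a composite of isomorphisms between principal
  ideals is again one, and the cover is perfect.

  Conversely, in an almost perfect \<open>S\<close> the pairs \<open>(a\<^sup>+, a\<^sup>*)\<close> with \<open>a\<close> in a fixed \<open>\<sigma>\<close>-class form,
  by properness, the graph of an isomorphism between ideals of \<open>P\<^sub>S\<close>. Perfectness of \<open>\<sigma>\<close> makes this
  assignment a homomorphism on \<open>S/\<sigma>\<close>, and \<open>a \<mapsto> (a\<sigma>, a\<^sup>*)\<close> is the isomorphism onto \<open>W(S/\<sigma>,P\<^sub>S)\<close>. If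
  the class has a greatest element \<open>m\<close>, then its isomorphism is \<open>\<theta>\<^sub>m\<close>.
\<close>

section \<open>Projections of a restriction semigroup\<close>

context restriction_semigroup
begin

lemma plus_in_proj: "x \<in> carrier S \<Longrightarrow> rplus S x \<in> proj S"
  by (simp add: proj_def)

text \<open>Since every \<open>x^+\<close> is its own star and every star is its own plus,
  \<open>x^+\<close> is fixed by both unary operations.\<close>

lemma proj_iff: "e \<in> proj S \<longleftrightarrow> e \<in> carrier S \<and> rplus S e = e"
  unfolding proj_def using plus_closed plus_of_star star_of_plus by force

lemma star_in_proj: "x \<in> carrier S \<Longrightarrow> rstar S x \<in> proj S"
  by (simp add: proj_iff star_closed plus_of_star)

lemma proj_carrier: "e \<in> proj S \<Longrightarrow> e \<in> carrier S"
  and proj_plus: "e \<in> proj S \<Longrightarrow> rplus S e = e"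
  by (simp_all add: proj_iff)

lemma proj_star: "e \<in> proj S \<Longrightarrow> rstar S e = e"
  by (metis proj_iff star_of_plus)

lemma proj_idem: "e \<in> proj S \<Longrightarrow> e \<cdot> e = e"
  by (metis proj_iff plus_left)

lemma proj_comm: "\<lbrakk>e \<in> proj S; f \<in> proj S\<rbrakk> \<Longrightarrow> e \<cdot> f = f \<cdot> e"
  by (metis proj_iff plus_comm)

lemma proj_closed: "\<lbrakk>e \<in> proj S; f \<in> proj S\<rbrakk> \<Longrightarrow> e \<cdot> f \<in> proj S"
  by (metis proj_iff plus_plus closed)

lemma plus_proj_mult: "\<lbrakk>e \<in> proj S; x \<in> carrier S\<rbrakk> \<Longrightarrow> rplus S (e \<cdot> x) = e \<cdot> rplus S x"
  by (metis proj_iff plus_plus)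

lemma star_mult_proj: "\<lbrakk>e \<in> proj S; x \<in> carrier S\<rbrakk> \<Longrightarrow> rstar S (x \<cdot> e) = rstar S x \<cdot> e"
  by (metis proj_carrier proj_star star_star)

text \<open>The ample identities for an arbitrary projection, which is its own star and its own
  plus. They move a projection from one side of \<open>x\<close> to the other.\<close>

lemma proj_mult: "\<lbrakk>e \<in> proj S; x \<in> carrier S\<rbrakk> \<Longrightarrow> e \<cdot> x = x \<cdot> rstar S (e \<cdot> x)"
  by (metis proj_carrier proj_star star_ample)

lemma mult_proj: "\<lbrakk>e \<in> proj S; x \<in> carrier S\<rbrakk> \<Longrightarrow> x \<cdot> e = rplus S (x \<cdot> e) \<cdot> x"
  by (metis proj_carrier proj_plus plus_ample)

lemma plus_mult_le:
  assumes "x \<in> carrier S" "y \<in> carrier S"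
  shows "rplus S x \<cdot> rplus S (x \<cdot> y) = rplus S (x \<cdot> y)"
  by (metis assms assoc closed plus_closed plus_left plus_plus)

lemma star_mult_le:
  assumes "x \<in> carrier S" "y \<in> carrier S"
  shows "rstar S (x \<cdot> y) \<cdot> rstar S y = rstar S (x \<cdot> y)"
  by (metis assms assoc closed star_closed star_right star_star)

text \<open>By the ample identity \<open>x y^+ = (xy)^+ x\<close>, whose plus is
  \<open>(xy)^+ x^+\<close>; this is \<open>(xy)^+\<close> because \<open>(xy)^+\<close> lies below
  \<open>x^+\<close>.\<close>

lemma plus_mult:
  assumes "x \<in> carrier S" "y \<in> carrier S"
  shows "rplus S (x \<cdot> y) = rplus S (x \<cdot> rplus S y)"
  by (metis assms closed plus_ample plus_comm plus_mult_le plus_plus)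

lemma star_mult:
  assumes "x \<in> carrier S" "y \<in> carrier S"
  shows "rstar S (x \<cdot> y) = rstar S (rstar S x \<cdot> y)"
  by (metis assms closed star_ample star_comm star_mult_le star_star)

lemma semilattice_proj: "semilattice_algebra (proj_semilattice S)"
proof
  show "carrier (proj_semilattice S) \<noteq> {}"
    using nonempty by (simp add: proj_semilattice_def proj_def)
qed (auto simp: proj_semilattice_def proj_closed proj_carrier assoc proj_idem intro: proj_comm)

section \<open>Natural order and identity element\<close>

lemma natural_le_proj:
  assumes "e \<in> proj S" "f \<in> proj S"
  shows "natural_le S e f \<longleftrightarrow> e = e \<cdot> f"
  unfolding natural_le_def using assms by (metis assoc proj_carrier proj_idem)

text \<open>Makes the greatest element of a class unique, so that the description in
  \<open>greatest_of\<close> denotes it. The proof commutes the two projections that witness the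
  inequalities.\<close>

lemma natural_le_antisym:
  assumes "natural_le S a b" "natural_le S b a" "a \<in> carrier S" "b \<in> carrier S"
  shows "a = b"
proof -
  obtain e f where e: "e \<in> proj S" "a = e \<cdot> b" and f: "f \<in> proj S" "b = f \<cdot> a"
    using assms(1,2) by (auto simp: natural_le_def)
  have fb: "f \<cdot> b = b"
    by (metis assms(3) assoc f proj_carrier proj_idem)
  have "a = e \<cdot> (f \<cdot> b)" by (simp add: fb e(2)[symmetric])
  also have "\<dots> = f \<cdot> (e \<cdot> b)"
    by (metis assms(4) assoc e(1) f(1) proj_carrier proj_comm)
  also have "\<dots> = b" using e(2) f(2) by simp
  finally show ?thesis .
qed

text \<open>The product \<open>i^+ i\<close> is \<open>i\<close> by the left law of plus and
  \<open>i^+\<close> because \<open>i\<close> is an identity.\<close>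

lemma identity_in_proj:
  assumes "is_identity S i"
  shows "i \<in> proj S"
proof -
  have i: "i \<in> carrier S" using assms by (simp add: is_identity_def)
  have "rplus S i \<cdot> i = rplus S i"
    using assms plus_closed[OF i] by (simp add: is_identity_def)
  then show ?thesis by (simp add: proj_iff i plus_left)
qed

lemma has_identity_proj:
  assumes "has_identity S"
  shows "has_identity (proj_semilattice S)"
proof -
  obtain i where "is_identity S i" using assms by (auto simp: has_identity_def)
  then have "is_identity (proj_semilattice S) i"
    using identity_in_proj[of i] by (simp add: is_identity_def proj_semilattice_def proj_carrier)
  then show ?thesis by (auto simp: has_identity_def)
qed

end

lemma identity_unique:
  assumes "is_identity X e" "is_identity X f"
  shows "e = f"
  using assms unfolding is_identity_def by metis


section \<open>Partial isomorphisms of a semilattice\<close>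

context semilattice_algebra
begin

section \<open>Meets and ideals in a semilattice\<close>

lemma left_comm:
  "\<lbrakk>e \<in> carrier Y; f \<in> carrier Y; g \<in> carrier Y\<rbrakk> \<Longrightarrow> e \<cdot> (f \<cdot> g) = f \<cdot> (e \<cdot> g)"
  by (metis assoc comm)

lemma left_idem: "\<lbrakk>e \<in> carrier Y; f \<in> carrier Y\<rbrakk> \<Longrightarrow> e \<cdot> (e \<cdot> f) = e \<cdot> f"
  by (metis assoc idem)

lemmas ac = assoc comm left_comm idem left_idem closed

text \<open>The elements below \<open>e\<close> are exactly the products \<open>e \<cdot> f\<close>,
  so downward closure becomes absorption under meets, the form used in all later
  calculations.\<close>

lemma is_ideal_iff:
  "is_ideal Y I \<longleftrightarrow> I \<noteq> {} \<and> I \<subseteq> carrier Y \<and> (\<forall>e\<in>I. \<forall>f\<in>carrier Y. e \<cdot> f \<in> I)"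
proof -
  have "down Y e = {e \<cdot> f |f. f \<in> carrier Y}" if "e \<in> carrier Y" for e
  proof -
    have "x = x \<cdot> e \<longleftrightarrow> (\<exists>f. x = e \<cdot> f \<and> f \<in> carrier Y)" if "x \<in> carrier Y" for x
      using that \<open>e \<in> carrier Y\<close> by (metis comm left_idem)
    then show ?thesis using that closed by (auto simp: down_def)
  qed
  then have "down Y e \<subseteq> I \<longleftrightarrow> (\<forall>f\<in>carrier Y. e \<cdot> f \<in> I)" if "e \<in> carrier Y" for e
    using that by auto
  then show ?thesis unfolding is_ideal_def by blast
qed

lemma is_ideal_down: "e \<in> carrier Y \<Longrightarrow> is_ideal Y (down Y e)"
proof -
  assume e: "e \<in> carrier Y"
  then have "e \<in> down Y e" by (simp add: down_def idem)
  moreover have "x \<cdot> f = x \<cdot> f \<cdot> e" if "x = x \<cdot> e" "x \<in> carrier Y" "f \<in> carrier Y" for x f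
    using e that by (metis assoc comm)
  ultimately show ?thesis by (auto simp: is_ideal_iff down_def closed)
qed

lemma is_principal_ideal_is_ideal: "is_principal_ideal Y I \<Longrightarrow> is_ideal Y I"
  by (auto simp: is_principal_ideal_def is_ideal_down)

section \<open>Isomorphisms between ideals and their composition\<close>

lemma TI_carrier_iff:
  "\<alpha> \<in> carrier (TI Y) \<longleftrightarrow> is_ideal Y (dom \<alpha>) \<and> is_ideal Y (ran \<alpha>) \<and>
     (\<forall>e f x. \<alpha> e = Some x \<and> \<alpha> f = Some x \<longrightarrow> e = f) \<and>
     (\<forall>e f x y. \<alpha> e = Some x \<and> \<alpha> f = Some y \<longrightarrow> \<alpha> (e \<cdot> f) = Some (x \<cdot> y))"
  by (auto simp: TI_def inj_on_def dom_def)

lemma TI_dom_carrier: "\<lbrakk>\<alpha> \<in> carrier (TI Y); \<alpha> e = Some x\<rbrakk> \<Longrightarrow> e \<in> carrier Y"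
  and TI_ran_carrier: "\<lbrakk>\<alpha> \<in> carrier (TI Y); \<alpha> e = Some x\<rbrakk> \<Longrightarrow> x \<in> carrier Y"
  and TI_inj: "\<lbrakk>\<alpha> \<in> carrier (TI Y); \<alpha> e = Some x; \<alpha> f = Some x\<rbrakk> \<Longrightarrow> e = f"
  and TI_meet: "\<lbrakk>\<alpha> \<in> carrier (TI Y); \<alpha> e = Some x; \<alpha> f = Some y\<rbrakk> \<Longrightarrow> \<alpha> (e \<cdot> f) = Some (x \<cdot> y)"
  unfolding TI_carrier_iff is_ideal_iff by (blast intro: domI ranI)+

lemma TI_dom_ideal:
  "\<lbrakk>\<alpha> \<in> carrier (TI Y); \<alpha> e = Some x; f \<in> carrier Y\<rbrakk> \<Longrightarrow> \<exists>y. \<alpha> (e \<cdot> f) = Some y"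
  and TI_ran_ideal:
  "\<lbrakk>\<alpha> \<in> carrier (TI Y); \<alpha> e = Some x; f \<in> carrier Y\<rbrakk> \<Longrightarrow> \<exists>g. \<alpha> g = Some (x \<cdot> f)"
  and TI_nonempty: "\<alpha> \<in> carrier (TI Y) \<Longrightarrow> \<exists>e x. \<alpha> e = Some x"
  unfolding TI_carrier_iff is_ideal_iff by (auto 0 4 simp: dom_def ran_def)

lemma TI_mult_closed:
  assumes a: "\<alpha> \<in> carrier (TI Y)" and b: "\<beta> \<in> carrier (TI Y)"
  shows "\<beta> \<circ>\<^sub>m \<alpha> \<in> carrier (TI Y)"
  unfolding TI_carrier_iff
proof (intro conjI allI impI)
  \<comment> \<open>For nonemptiness take \<open>x\<close> in the range of \<alpha> and
    \<open>f\<close> in the domain of \<beta>: their meet lies in both ideals, so the composite is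
    defined at a preimage of it.\<close>
  obtain e x f y where ex: "\<alpha> e = Some x" and fy: "\<beta> f = Some y"
    using TI_nonempty a b by metis
  have "x \<in> carrier Y" "f \<in> carrier Y"
    using ex fy a b TI_ran_carrier TI_dom_carrier by blast+
  then obtain g z where gz: "\<alpha> g = Some (x \<cdot> f)" "\<beta> (x \<cdot> f) = Some z"
    using TI_ran_ideal[OF a ex] TI_dom_ideal[OF b fy] by (metis comm)
  then have "dom (\<beta> \<circ>\<^sub>m \<alpha>) \<noteq> {}" "ran (\<beta> \<circ>\<^sub>m \<alpha>) \<noteq> {}"
    by (auto simp: map_comp_Some_iff dom_def ran_def)
  moreover have "dom (\<beta> \<circ>\<^sub>m \<alpha>) \<subseteq> carrier Y" "ran (\<beta> \<circ>\<^sub>m \<alpha>) \<subseteq> carrier Y"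
    using a b TI_dom_carrier TI_ran_carrier
    by (auto simp: map_comp_Some_iff dom_def ran_def)
  moreover have "e \<cdot> f \<in> dom (\<beta> \<circ>\<^sub>m \<alpha>)"
    if e: "e \<in> dom (\<beta> \<circ>\<^sub>m \<alpha>)" and f: "f \<in> carrier Y" for e f
  proof -
    obtain x y where xy: "\<alpha> e = Some x" "\<beta> x = Some y"
      using e by (auto simp: map_comp_Some_iff dom_def)
    obtain z where z: "\<alpha> (e \<cdot> f) = Some z" using TI_dom_ideal[OF a xy(1) f] ..
    have "e \<in> carrier Y" using a xy(1) by (rule TI_dom_carrier)
    \<comment> \<open>Writing \<open>e \<cdot> f\<close> as \<open>e \<cdot> (e \<cdot> f)\<close>
      shows that its image lies below \<open>x\<close>, hence in the domain ideal of
      \<beta>.\<close>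
    then have "\<alpha> (e \<cdot> f) = Some (x \<cdot> z)"
      using TI_meet[OF a xy(1) z] f by (simp add: left_idem)
    moreover have "z \<in> carrier Y" using a z by (rule TI_ran_carrier)
    ultimately show ?thesis
      using TI_dom_ideal[OF b xy(2), of z] by (auto simp: map_comp_Some_iff dom_def)
  qed
  moreover have "y \<cdot> f \<in> ran (\<beta> \<circ>\<^sub>m \<alpha>)"
    if y: "y \<in> ran (\<beta> \<circ>\<^sub>m \<alpha>)" and f: "f \<in> carrier Y" for y f
  proof -
    obtain e x where ex: "\<alpha> e = Some x" "\<beta> x = Some y"
      using y by (auto simp: map_comp_Some_iff ran_def)
    obtain z where z: "\<beta> z = Some (y \<cdot> f)" using TI_ran_ideal[OF b ex(2) f] ..
    have "y \<in> carrier Y" using b ex(2) by (rule TI_ran_carrier)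
    \<comment> \<open>Replacing the preimage \<open>z\<close> by \<open>x \<cdot> z\<close> keeps
      its image and brings it into the range ideal of \<alpha>.\<close>
    then have "\<beta> (x \<cdot> z) = Some (y \<cdot> f)"
      using TI_meet[OF b ex(2) z] f by (simp add: left_idem)
    moreover have "z \<in> carrier Y" using b z by (rule TI_dom_carrier)
    ultimately show ?thesis
      using TI_ran_ideal[OF a ex(1), of z] by (auto simp: map_comp_Some_iff ran_def)
  qed
  ultimately show "is_ideal Y (dom (\<beta> \<circ>\<^sub>m \<alpha>))" "is_ideal Y (ran (\<beta> \<circ>\<^sub>m \<alpha>))"
    by (simp_all add: is_ideal_iff)
next
  fix e f x assume "(\<beta> \<circ>\<^sub>m \<alpha>) e = Some x \<and> (\<beta> \<circ>\<^sub>m \<alpha>) f = Some x"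
  then show "e = f" using TI_inj[OF a] TI_inj[OF b] by (auto simp: map_comp_Some_iff)
next
  fix e f x y assume "(\<beta> \<circ>\<^sub>m \<alpha>) e = Some x \<and> (\<beta> \<circ>\<^sub>m \<alpha>) f = Some y"
  then show "(\<beta> \<circ>\<^sub>m \<alpha>) (e \<cdot> f) = Some (x \<cdot> y)"
    using TI_meet[OF a] TI_meet[OF b] by (auto simp: map_comp_Some_iff)
qed

lemma TI_one: "\<one>\<^bsub>TI Y\<^esub> e = (if e \<in> carrier Y then Some e else None)"
  and TI_mult: "\<alpha> \<otimes>\<^bsub>TI Y\<^esub> \<beta> = \<beta> \<circ>\<^sub>m \<alpha>"
  by (simp_all add: TI_def)

lemma dom_TI_one: "dom \<one>\<^bsub>TI Y\<^esub> = carrier Y"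
  and ran_TI_one: "ran \<one>\<^bsub>TI Y\<^esub> = carrier Y"
  by (auto simp: TI_one dom_def ran_def split: if_splits)

lemma monoid_TI: "monoid (TI Y)"
proof
  show "\<one>\<^bsub>TI Y\<^esub> \<in> carrier (TI Y)"
    using nonempty closed
    by (auto simp: TI_carrier_iff dom_TI_one ran_TI_one is_ideal_iff) (auto simp: TI_one split: if_splits)
next
  fix \<alpha> assume a: "\<alpha> \<in> carrier (TI Y)"
  show "\<one>\<^bsub>TI Y\<^esub> \<otimes>\<^bsub>TI Y\<^esub> \<alpha> = \<alpha>" 
  proof
    fix e show "(\<one>\<^bsub>TI Y\<^esub> \<otimes>\<^bsub>TI Y\<^esub> \<alpha>) e = \<alpha> e"
      using TI_dom_carrier[OF a, of e] by (cases "\<alpha> e") (auto simp: TI_mult TI_one map_comp_def)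
  qed
  show "\<alpha> \<otimes>\<^bsub>TI Y\<^esub> \<one>\<^bsub>TI Y\<^esub> = \<alpha>"
  proof
    fix e show "(\<alpha> \<otimes>\<^bsub>TI Y\<^esub> \<one>\<^bsub>TI Y\<^esub>) e = \<alpha> e"
      using TI_ran_carrier[OF a, of e] by (cases "\<alpha> e") (auto simp: TI_mult TI_one map_comp_def)
  qed
next
  fix \<alpha> \<beta> \<gamma> assume "\<alpha> \<in> carrier (TI Y)" "\<beta> \<in> carrier (TI Y)"
  then show "\<alpha> \<otimes>\<^bsub>TI Y\<^esub> \<beta> \<in> carrier (TI Y)" by (simp add: TI_mult TI_mult_closed)
  show "(\<alpha> \<otimes>\<^bsub>TI Y\<^esub> \<beta>) \<otimes>\<^bsub>TI Y\<^esub> \<gamma> = \<alpha> \<otimes>\<^bsub>TI Y\<^esub> (\<beta> \<otimes>\<^bsub>TI Y\<^esub> \<gamma>)"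
    by (auto simp: TI_mult map_comp_def fun_eq_iff split: option.splits)
qed

section \<open>Principal ideals and the Munn semigroup\<close>

lemma down_meet:
  "\<lbrakk>e \<in> carrier Y; f \<in> carrier Y\<rbrakk> \<Longrightarrow> down Y e \<inter> down Y f = down Y (e \<cdot> f)"
proof -
  assume e: "e \<in> carrier Y" and f: "f \<in> carrier Y"
  have "x = x \<cdot> e \<and> x = x \<cdot> f \<longleftrightarrow> x = x \<cdot> (e \<cdot> f)" if "x \<in> carrier Y" for x
    using e f that by (metis assoc closed comm left_idem)
  then show ?thesis by (auto simp: down_def)
qed

text \<open>Because \<alpha> preserves meets and is injective, \<open>f = f \<cdot> e\<close> holds
  exactly when the images satisfy the same relation; because the range is an ideal, everything below
  \<open>x\<close> is hit. So \<alpha> restricts to a bijection between the two principal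
  ideals.\<close>

lemma TI_image_down:
  assumes a: "\<alpha> \<in> carrier (TI Y)" and e: "\<alpha> e = Some x"
  shows "f \<in> down Y e \<longleftrightarrow> (\<exists>y \<in> down Y x. \<alpha> f = Some y)"
    and "y \<in> down Y x \<longleftrightarrow> (\<exists>f \<in> down Y e. \<alpha> f = Some y)"
proof -
  have ec: "e \<in> carrier Y" and xc: "x \<in> carrier Y"
    using TI_dom_carrier[OF a e] TI_ran_carrier[OF a e] .
  show *: "f \<in> down Y e \<longleftrightarrow> (\<exists>y \<in> down Y x. \<alpha> f = Some y)" for f
  proof
    assume f: "f \<in> down Y e"
    then obtain y where y: "\<alpha> f = Some y"
      using TI_dom_ideal[OF a e, of f] ec by (auto simp: down_def comm)
    then have "y \<in> down Y x"
      using f TI_meet[OF a y e] TI_ran_carrier[OF a y] by (auto simp: down_def)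
    with y show "\<exists>y \<in> down Y x. \<alpha> f = Some y" by auto
  next
    assume "\<exists>y \<in> down Y x. \<alpha> f = Some y"
    then obtain y where y: "\<alpha> f = Some y" "y = y \<cdot> x" by (auto simp: down_def)
    then have "\<alpha> (f \<cdot> e) = Some y" using TI_meet[OF a y(1) e] by simp
    then have "f = f \<cdot> e" using TI_inj[OF a y(1)] by blast
    then show "f \<in> down Y e" using TI_dom_carrier[OF a y(1)] by (simp add: down_def)
  qed
  show "y \<in> down Y x \<longleftrightarrow> (\<exists>f \<in> down Y e. \<alpha> f = Some y)"
  proof
    assume y: "y \<in> down Y x"
    then obtain f where "\<alpha> f = Some y"
      using TI_ran_ideal[OF a e, of y] xc by (auto simp: down_def comm)
    then show "\<exists>f \<in> down Y e. \<alpha> f = Some y" using y * by blast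
  next
    assume "\<exists>f \<in> down Y e. \<alpha> f = Some y"
    then show "y \<in> down Y x" using * by force
  qed
qed

text \<open>The overlap of the range of \<alpha> with the domain of \<beta> is the principal ideal
  of \<open>p \<cdot> q\<close>. Its preimage under \<alpha> and its image under \<beta> are the
  domain and range of the composite, and both stay principal.\<close>

lemma munn_semigroup_mult_closed:
  assumes "\<alpha> \<in> munn_semigroup Y" "\<beta> \<in> munn_semigroup Y"
  shows "\<beta> \<circ>\<^sub>m \<alpha> \<in> munn_semigroup Y"
proof -
  have a: "\<alpha> \<in> carrier (TI Y)" and b: "\<beta> \<in> carrier (TI Y)"
    using assms by (auto simp: munn_semigroup_def)
  obtain p q where p: "p \<in> carrier Y" "ran \<alpha> = down Y p"
    and q: "q \<in> carrier Y" "dom \<beta> = down Y q"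
    using assms by (auto simp: munn_semigroup_def is_principal_ideal_def)
  have mid: "ran \<alpha> \<inter> dom \<beta> = down Y (p \<cdot> q)" using p q down_meet by simp
  moreover have "p \<cdot> q \<in> down Y (p \<cdot> q)" using p q by (simp add: down_def idem closed)
  ultimately have "p \<cdot> q \<in> ran \<alpha>" "p \<cdot> q \<in> dom \<beta>" by blast+
  then obtain e y where e: "\<alpha> e = Some (p \<cdot> q)" and y: "\<beta> (p \<cdot> q) = Some y"
    by (auto simp: ran_def)
  have "dom (\<beta> \<circ>\<^sub>m \<alpha>) = {x. \<exists>z \<in> ran \<alpha> \<inter> dom \<beta>. \<alpha> x = Some z}"
    by (auto simp: dom_def map_comp_Some_iff ran_def)
  also have "\<dots> = down Y e" using TI_image_down(1)[OF a e] mid by blast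
  finally have "dom (\<beta> \<circ>\<^sub>m \<alpha>) = down Y e" .
  moreover have "ran (\<beta> \<circ>\<^sub>m \<alpha>) = {z. \<exists>x \<in> ran \<alpha> \<inter> dom \<beta>. \<beta> x = Some z}"
    by (auto simp: dom_def map_comp_Some_iff ran_def)
  then have "ran (\<beta> \<circ>\<^sub>m \<alpha>) = down Y y" using TI_image_down(2)[OF b y] mid by blast
  ultimately show ?thesis
    using TI_mult_closed[OF a b] TI_dom_carrier[OF a e] TI_ran_carrier[OF b y]
    unfolding munn_semigroup_def is_principal_ideal_def by blast
qed

text \<open>An identity of \<open>Y\<close> generates the whole of \<open>Y\<close> as a principal
  ideal.\<close>

lemma TI_one_in_munn_semigroup:
  assumes "has_identity Y"
  shows "\<one>\<^bsub>TI Y\<^esub> \<in> munn_semigroup Y"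
proof -
  obtain i where "is_identity Y i" using assms by (auto simp: has_identity_def)
  then have "i \<in> carrier Y" "down Y i = carrier Y"
    by (auto simp: is_identity_def down_def)
  then have "is_principal_ideal Y (carrier Y)" by (auto simp: is_principal_ideal_def)
  then show ?thesis
    using monoid.one_closed[OF monoid_TI] by (simp add: munn_semigroup_def dom_TI_one ran_TI_one)
qed

end


section \<open>The semigroup \<open>W(T,Y)\<close>\<close>

locale ideal_action =
  T: monoid T + semilattice_algebra Y
  for T :: "('t, 'n) monoid_scheme" and Y :: "('y, 'm) magma_scheme" (structure) +
  fixes \<alpha> :: "'t \<Rightarrow> 'y \<rightharpoonup> 'y"
  assumes acts: "acts_by_ideal_isos T Y \<alpha>"
begin

abbreviation W' :: "('t \<times> 'y) restr" where
  "W' \<equiv> W T Y \<alpha>"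

section \<open>The action written as \<open>e^t\<close>\<close>

lemma action_in_TI: "t \<in> carrier T \<Longrightarrow> \<alpha> t \<in> carrier (TI Y)"
  using acts by (auto simp: acts_by_ideal_isos_def hom_def)

lemma dom_carrier: "\<lbrakk>t \<in> carrier T; e \<in> dom (\<alpha> t)\<rbrakk> \<Longrightarrow> e \<in> carrier Y"
  using TI_dom_carrier[OF action_in_TI] by blast

lemma act_closed: "\<lbrakk>t \<in> carrier T; e \<in> dom (\<alpha> t)\<rbrakk> \<Longrightarrow> act \<alpha> t e \<in> carrier Y"
  using TI_ran_carrier[OF action_in_TI] by (auto simp: act_def)

lemma dom_meet: "\<lbrakk>t \<in> carrier T; e \<in> dom (\<alpha> t); f \<in> carrier Y\<rbrakk> \<Longrightarrow> e \<cdot> f \<in> dom (\<alpha> t)"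
  using TI_dom_ideal[OF action_in_TI] by blast

lemma dom_meet': "\<lbrakk>t \<in> carrier T; e \<in> dom (\<alpha> t); f \<in> carrier Y\<rbrakk> \<Longrightarrow> f \<cdot> e \<in> dom (\<alpha> t)"
  using dom_meet comm dom_carrier by metis

lemma act_meet:
  "\<lbrakk>t \<in> carrier T; e \<in> dom (\<alpha> t); f \<in> dom (\<alpha> t)\<rbrakk> \<Longrightarrow> act \<alpha> t (e \<cdot> f) = act \<alpha> t e \<cdot> act \<alpha> t f"
  using TI_meet[OF action_in_TI] by (fastforce simp: act_def dom_def)

text \<open>The range of \<alpha> at \<open>t\<close> is an ideal and so contains the meet of
  \<open>e^t\<close> with \<open>f\<close>. Its preimage \<open>g\<close> lies below
  \<open>e\<close>, since \<open>g \<cdot> e\<close> has the same image as \<open>g\<close>.\<close>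

lemma act_restrict:
  assumes "t \<in> carrier T" "e \<in> dom (\<alpha> t)" "f \<in> carrier Y"
  obtains g where "g \<in> dom (\<alpha> t)" "act \<alpha> t g = act \<alpha> t e \<cdot> f" "g \<cdot> e = g"
proof -
  obtain x where x: "\<alpha> t e = Some x" using assms(2) by blast
  obtain g where g: "\<alpha> t g = Some (x \<cdot> f)"
    using TI_ran_ideal[OF action_in_TI[OF assms(1)] x assms(3)] ..
  have xc: "x \<in> carrier Y" using TI_ran_carrier[OF action_in_TI[OF assms(1)] x] .
  have "\<alpha> t (g \<cdot> e) = Some (x \<cdot> f \<cdot> x)"
    using TI_meet[OF action_in_TI[OF assms(1)] g x] .
  also have "x \<cdot> f \<cdot> x = x \<cdot> f" using xc assms(3) by (simp add: ac)
  finally have "g \<cdot> e = g" using TI_inj[OF action_in_TI[OF assms(1)] _ g] by blast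
  then show ?thesis using that[of g] g x by (auto simp: act_def)
qed

lemma action_one: "\<alpha> \<one>\<^bsub>T\<^esub> = \<one>\<^bsub>TI Y\<^esub>"
  using acts by (simp add: acts_by_ideal_isos_def)

lemma dom_one: "dom (\<alpha> \<one>\<^bsub>T\<^esub>) = carrier Y"
  by (simp add: action_one dom_TI_one)

lemma act_one: "e \<in> carrier Y \<Longrightarrow> act \<alpha> \<one>\<^bsub>T\<^esub> e = e"
  by (simp add: action_one TI_one act_def)

lemma action_mult:
  "\<lbrakk>t \<in> carrier T; u \<in> carrier T\<rbrakk> \<Longrightarrow> \<alpha> (t \<otimes>\<^bsub>T\<^esub> u) = \<alpha> u \<circ>\<^sub>m \<alpha> t"
  using acts by (simp add: acts_by_ideal_isos_def hom_def TI_mult)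

lemma dom_mult:
  assumes "t \<in> carrier T" "u \<in> carrier T"
  shows "e \<in> dom (\<alpha> (t \<otimes>\<^bsub>T\<^esub> u)) \<longleftrightarrow> e \<in> dom (\<alpha> t) \<and> act \<alpha> t e \<in> dom (\<alpha> u)"
  using assms by (auto simp: action_mult act_def map_comp_Some_iff dom_def)

lemma act_mult:
  "\<lbrakk>t \<in> carrier T; u \<in> carrier T; e \<in> dom (\<alpha> t)\<rbrakk>
    \<Longrightarrow> act \<alpha> (t \<otimes>\<^bsub>T\<^esub> u) e = act \<alpha> u (act \<alpha> t e)"
  by (auto simp: action_mult act_def)

section \<open>Elements and products of \<open>W\<close>\<close>

lemma W_cases:
  assumes "x \<in> carrier W'"
  obtains t e where "x = (t, act \<alpha> t e)" "t \<in> carrier T" "e \<in> dom (\<alpha> t)"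
  using assms by (auto simp: W_def)

lemma W_cases_fst:
  assumes "x \<in> carrier W'" "fst x = t"
  obtains e where "x = (t, act \<alpha> t e)" "e \<in> dom (\<alpha> t)"
proof -
  obtain u e where "x = (u, act \<alpha> u e)" "e \<in> dom (\<alpha> u)" using assms(1) by (rule W_cases)
  then show ?thesis using that[of e] assms(2) by simp
qed

lemma W_carrierI: "\<lbrakk>t \<in> carrier T; e \<in> dom (\<alpha> t)\<rbrakk> \<Longrightarrow> (t, act \<alpha> t e) \<in> carrier W'"
  by (auto simp: W_def)

lemma W_one_carrier: "(\<one>\<^bsub>T\<^esub>, e) \<in> carrier W' \<longleftrightarrow> e \<in> carrier Y"
  by (simp add: carrier_W action_one ran_TI_one)

lemmas W_plus' = W_plus[OF acts]

text \<open>Only the right factor is put in the form \<open>(u, f^u)\<close>, because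
  \<open>unact\<close> is applied to that factor alone; the left factor may be any pair.\<close>

lemma W_mult':
  "\<lbrakk>u \<in> carrier T; f \<in> dom (\<alpha> u)\<rbrakk>
    \<Longrightarrow> (t, g) \<cdot>\<^bsub>W'\<^esub> (u, act \<alpha> u f) = (t \<otimes>\<^bsub>T\<^esub> u, act \<alpha> u (g \<cdot> f))"
  by (simp add: W_def unact_act[OF acts])

lemma W_one_mult:
  assumes "e \<in> carrier Y" "t \<in> carrier T" "f \<in> dom (\<alpha> t)"
  shows "(\<one>\<^bsub>T\<^esub>, e) \<cdot>\<^bsub>W'\<^esub> (t, act \<alpha> t f) = (t, act \<alpha> t (e \<cdot> f))"
  using W_mult'[of t f "\<one>\<^bsub>T\<^esub>" e] assms by simp

lemma W_mult_one:
  assumes "t \<in> carrier T" "g \<in> carrier Y" "f \<in> carrier Y"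
  shows "(t, g) \<cdot>\<^bsub>W'\<^esub> (\<one>\<^bsub>T\<^esub>, f) = (t, g \<cdot> f)"
proof -
  have "unact \<alpha> \<one>\<^bsub>T\<^esub> f = f"
    using unact_act[OF acts, of "\<one>\<^bsub>T\<^esub>" f] assms by (simp add: dom_one act_one)
  then show ?thesis using assms closed by (simp add: W_def act_one)
qed

lemma W_plus_one: "e \<in> carrier Y \<Longrightarrow> rplus W' (\<one>\<^bsub>T\<^esub>, e) = (\<one>\<^bsub>T\<^esub>, e)"
  using W_plus'[of "\<one>\<^bsub>T\<^esub>" e] by (simp add: dom_one act_one)

text \<open>The product is defined through its second coordinate, that is, its star. Here it is
  rewritten through its plus: \<open>g\<close> is the preimage under \<open>t\<close> of the meet
  \<open>e^t f\<close>, and acting by \<open>u\<close> on both sides gives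
  \<open>g^(tu) = (e^t f)^u\<close>.\<close>

lemma W_mult_left:
  assumes "t \<in> carrier T" "e \<in> dom (\<alpha> t)" "u \<in> carrier T" "f \<in> dom (\<alpha> u)"
  obtains g where "g \<in> dom (\<alpha> t)" "act \<alpha> t g = act \<alpha> t e \<cdot> f" "g \<cdot> e = g"
    "g \<in> dom (\<alpha> (t \<otimes>\<^bsub>T\<^esub> u))"
    "(t, act \<alpha> t e) \<cdot>\<^bsub>W'\<^esub> (u, act \<alpha> u f) = (t \<otimes>\<^bsub>T\<^esub> u, act \<alpha> (t \<otimes>\<^bsub>T\<^esub> u) g)"
proof -
  obtain g where g: "g \<in> dom (\<alpha> t)" "act \<alpha> t g = act \<alpha> t e \<cdot> f" "g \<cdot> e = g"
    using act_restrict assms dom_carrier by metis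
  moreover have "g \<in> dom (\<alpha> (t \<otimes>\<^bsub>T\<^esub> u))"
    using assms g by (simp add: dom_mult dom_meet' act_closed)
  moreover have "(t, act \<alpha> t e) \<cdot>\<^bsub>W'\<^esub> (u, act \<alpha> u f) =
      (t \<otimes>\<^bsub>T\<^esub> u, act \<alpha> (t \<otimes>\<^bsub>T\<^esub> u) g)"
    using assms g by (simp add: W_mult' act_mult)
  ultimately show ?thesis using that by blast
qed

section \<open>The restriction identities in \<open>W\<close>\<close>

lemma W_assoc:
  assumes "x \<in> carrier W'" "y \<in> carrier W'" "z \<in> carrier W'"
  shows "(x \<cdot>\<^bsub>W'\<^esub> y) \<cdot>\<^bsub>W'\<^esub> z = x \<cdot>\<^bsub>W'\<^esub> (y \<cdot>\<^bsub>W'\<^esub> z)"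
proof -
  obtain t e where x: "x = (t, act \<alpha> t e)" "t \<in> carrier T" "e \<in> dom (\<alpha> t)"
    using assms(1) by (rule W_cases)
  obtain u f where y: "y = (u, act \<alpha> u f)" "u \<in> carrier T" "f \<in> dom (\<alpha> u)"
    using assms(2) by (rule W_cases)
  obtain v h where z: "z = (v, act \<alpha> v h)" "v \<in> carrier T" "h \<in> dom (\<alpha> v)"
    using assms(3) by (rule W_cases)
  \<comment> \<open>The projection \<open>k\<close> is the plus coordinate of \<open>yz\<close>,
    which puts this right factor into the form required by the product formula.\<close>
  obtain k where k: "k \<in> dom (\<alpha> u)" "act \<alpha> u k = act \<alpha> u f \<cdot> h" "k \<cdot> f = k"
      "k \<in> dom (\<alpha> (u \<otimes>\<^bsub>T\<^esub> v))"
      "y \<cdot>\<^bsub>W'\<^esub> z = (u \<otimes>\<^bsub>T\<^esub> v, act \<alpha> (u \<otimes>\<^bsub>T\<^esub> v) k)"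
    unfolding y(1) z(1) using W_mult_left y z by metis
  have uv: "u \<otimes>\<^bsub>T\<^esub> v \<in> carrier T" using y z by simp
  have te: "act \<alpha> t e \<in> carrier Y" using x act_closed by simp
  have tek: "act \<alpha> t e \<cdot> k \<in> dom (\<alpha> u)" using te k y dom_meet' by simp
  have tef: "act \<alpha> t e \<cdot> f \<in> dom (\<alpha> u)" using te y dom_meet' by simp
  have kc: "k \<in> carrier Y" and fc: "f \<in> carrier Y" and hc: "h \<in> carrier Y"
    using k y z dom_carrier by blast+
  have "x \<cdot>\<^bsub>W'\<^esub> (y \<cdot>\<^bsub>W'\<^esub> z) =
      (t \<otimes>\<^bsub>T\<^esub> (u \<otimes>\<^bsub>T\<^esub> v), act \<alpha> v (act \<alpha> u (act \<alpha> t e \<cdot> k)))"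
    unfolding k(5) x(1) W_mult'[OF uv k(4)] using act_mult y z tek by simp
  \<comment> \<open>Since \<open>k\<close> lies below \<open>f\<close>, inserting \<open>f\<close>
    writes the argument as a meet of two elements of the domain of \<open>u\<close>, where the
    action preserves meets.\<close>
  also have "act \<alpha> t e \<cdot> k = (act \<alpha> t e \<cdot> f) \<cdot> k"
    by (metis assoc comm fc k(3) kc te)
  also have "act \<alpha> u \<dots> = act \<alpha> u (act \<alpha> t e \<cdot> f) \<cdot> (act \<alpha> u f \<cdot> h)"
    using y tef k by (simp add: act_meet)
  also have "\<dots> = act \<alpha> u (act \<alpha> t e \<cdot> f) \<cdot> act \<alpha> u f \<cdot> h"
    using y tef hc by (simp add: assoc act_closed)
  also have "act \<alpha> u (act \<alpha> t e \<cdot> f) \<cdot> act \<alpha> u f = act \<alpha> u (act \<alpha> t e \<cdot> f)"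
    using act_meet[OF y(2) tef y(3)] te fc by (simp add: assoc idem)
  finally have "x \<cdot>\<^bsub>W'\<^esub> (y \<cdot>\<^bsub>W'\<^esub> z) =
      (t \<otimes>\<^bsub>T\<^esub> (u \<otimes>\<^bsub>T\<^esub> v), act \<alpha> v (act \<alpha> u (act \<alpha> t e \<cdot> f) \<cdot> h))" .
  moreover have "(x \<cdot>\<^bsub>W'\<^esub> y) \<cdot>\<^bsub>W'\<^esub> z =
      (t \<otimes>\<^bsub>T\<^esub> (u \<otimes>\<^bsub>T\<^esub> v), act \<alpha> v (act \<alpha> u (act \<alpha> t e \<cdot> f) \<cdot> h))"
    unfolding x(1) y(1) z(1) W_mult'[OF y(2,3)] W_mult'[OF z(2,3)]
    using x y z by (simp add: T.m_assoc)
  ultimately show ?thesis by simp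
qed

text \<open>Both sides equal \<open>(t, g^t)\<close>, where \<open>g\<close> is the plus coordinate
  of \<open>xy\<close>.\<close>

lemma W_plus_ample:
  assumes "x \<in> carrier W'" "y \<in> carrier W'"
  shows "x \<cdot>\<^bsub>W'\<^esub> rplus W' y = rplus W' (x \<cdot>\<^bsub>W'\<^esub> y) \<cdot>\<^bsub>W'\<^esub> x"
proof -
  obtain t e where x: "x = (t, act \<alpha> t e)" "t \<in> carrier T" "e \<in> dom (\<alpha> t)"
    using assms(1) by (rule W_cases)
  obtain u f where y: "y = (u, act \<alpha> u f)" "u \<in> carrier T" "f \<in> dom (\<alpha> u)"
    using assms(2) by (rule W_cases)
  obtain g where g: "g \<in> dom (\<alpha> t)" "act \<alpha> t g = act \<alpha> t e \<cdot> f" "g \<cdot> e = g"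
      "g \<in> dom (\<alpha> (t \<otimes>\<^bsub>T\<^esub> u))"
      "x \<cdot>\<^bsub>W'\<^esub> y = (t \<otimes>\<^bsub>T\<^esub> u, act \<alpha> (t \<otimes>\<^bsub>T\<^esub> u) g)"
    unfolding x(1) y(1) using W_mult_left x y by metis
  have fc: "f \<in> carrier Y" using y dom_carrier by blast
  have gc: "g \<in> carrier Y" using g x dom_carrier by blast
  have "x \<cdot>\<^bsub>W'\<^esub> rplus W' y = (t, act \<alpha> t g)"
    using x y fc g by (simp add: W_plus' W_mult_one act_closed)
  moreover have "rplus W' (x \<cdot>\<^bsub>W'\<^esub> y) = (\<one>\<^bsub>T\<^esub>, g)"
    using x y g by (simp add: W_plus')
  ultimately show ?thesis using x gc g(3) by (simp add: W_one_mult)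
qed

text \<open>Both sides equal \<open>(t, (f^u e)^t)\<close>. On the right the additional factor
  \<open>e^t\<close> is absorbed, since \<open>(f^u e)^t\<close> lies below it.\<close>

lemma W_star_ample:
  assumes "x \<in> carrier W'" "y \<in> carrier W'"
  shows "rstar W' y \<cdot>\<^bsub>W'\<^esub> x = x \<cdot>\<^bsub>W'\<^esub> rstar W' (y \<cdot>\<^bsub>W'\<^esub> x)"
proof -
  obtain t e where x: "x = (t, act \<alpha> t e)" "t \<in> carrier T" "e \<in> dom (\<alpha> t)"
    using assms(1) by (rule W_cases)
  obtain u f where y: "y = (u, act \<alpha> u f)" "u \<in> carrier T" "f \<in> dom (\<alpha> u)"
    using assms(2) by (rule W_cases)
  have g: "act \<alpha> u f \<cdot> e \<in> dom (\<alpha> t)" "act \<alpha> u f \<in> carrier Y"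
    using x y by (simp_all add: dom_meet' act_closed)
  have "e \<in> carrier Y" using x dom_carrier by blast
  then have "act \<alpha> t e \<cdot> act \<alpha> t (act \<alpha> u f \<cdot> e) = act \<alpha> t (act \<alpha> u f \<cdot> e)"
    using act_meet[OF x(2,3) g(1)] g(2) by (simp add: ac)
  then show ?thesis
    using x y g by (simp add: W_mult' W_star W_one_mult W_mult_one act_closed)
qed

lemma restriction_semigroup_W: "restriction_semigroup W'"
proof
  show "carrier W' \<noteq> {}" using nonempty W_one_carrier by blast
next
  fix x y assume xy: "x \<in> carrier W'" "y \<in> carrier W'"
  obtain t e where x: "x = (t, act \<alpha> t e)" "t \<in> carrier T" "e \<in> dom (\<alpha> t)"
    using xy(1) by (rule W_cases)
  obtain u f where y: "y = (u, act \<alpha> u f)" "u \<in> carrier T" "f \<in> dom (\<alpha> u)"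
    using xy(2) by (rule W_cases)
  have e: "e \<in> carrier Y" "f \<in> carrier Y" using x y dom_carrier by blast+
  show "x \<cdot>\<^bsub>W'\<^esub> y \<in> carrier W'"
    using W_mult_left[OF x(2,3) y(2,3)] x y by (metis T.m_closed W_carrierI)
  show "rplus W' (rplus W' x \<cdot>\<^bsub>W'\<^esub> y) = rplus W' x \<cdot>\<^bsub>W'\<^esub> rplus W' y"
    using x y e by (simp add: W_plus' W_one_mult W_mult_one dom_meet')
  show "rplus W' x \<cdot>\<^bsub>W'\<^esub> rplus W' y = rplus W' y \<cdot>\<^bsub>W'\<^esub> rplus W' x"
    using x y e by (simp add: W_plus' W_mult_one comm)
  show "rstar W' (y \<cdot>\<^bsub>W'\<^esub> rstar W' x) = rstar W' y \<cdot>\<^bsub>W'\<^esub> rstar W' x"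
    using x y by (simp add: W_star W_mult_one act_closed)
  show "rstar W' y \<cdot>\<^bsub>W'\<^esub> rstar W' x = rstar W' x \<cdot>\<^bsub>W'\<^esub> rstar W' y"
    using x y by (simp add: W_star W_mult_one act_closed comm)
next
  fix x assume "x \<in> carrier W'"
  then obtain t e where x: "x = (t, act \<alpha> t e)" "t \<in> carrier T" "e \<in> dom (\<alpha> t)"
    by (rule W_cases)
  have e: "e \<in> carrier Y" using x dom_carrier by blast
  show "rplus W' x \<in> carrier W'" "rstar W' x \<in> carrier W'"
    using x e by (simp_all add: W_plus' W_star W_one_carrier act_closed)
  show "rplus W' x \<cdot>\<^bsub>W'\<^esub> x = x" "x \<cdot>\<^bsub>W'\<^esub> rstar W' x = x"
    using x e by (simp_all add: W_plus' W_star W_one_mult W_mult_one act_closed idem)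
  show "rstar W' (rplus W' x) = rplus W' x" "rplus W' (rstar W' x) = rstar W' x"
    using x e by (simp_all add: W_plus' W_star W_plus_one act_closed)
qed (fact W_assoc W_plus_ample W_star_ample)+

section \<open>Projections and the congruence \<sigma> of \<open>W\<close>\<close>

lemma proj_W: "proj W' = {\<one>\<^bsub>T\<^esub>} \<times> carrier Y"
proof -
  interpret W: restriction_semigroup W' by (rule restriction_semigroup_W)
  have "rplus W' x \<in> {\<one>\<^bsub>T\<^esub>} \<times> carrier Y" if "x \<in> carrier W'" for x
    using that
  proof (rule W_cases)
    fix t e assume "x = (t, act \<alpha> t e)" "t \<in> carrier T" "e \<in> dom (\<alpha> t)"
    then show ?thesis using dom_carrier by (simp add: W_plus')
  qed
  then have "proj W' \<subseteq> {\<one>\<^bsub>T\<^esub>} \<times> carrier Y" unfolding proj_def by blast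
  then show ?thesis
    by (auto simp: W.proj_iff W_plus_one W_one_carrier)
qed

text \<open>Projections have first coordinate the identity of \<open>T\<close>, so multiplying by
  one preserves the first coordinate. Conversely, \<open>(t, e^t)\<close> and
  \<open>(t, f^t)\<close> are equalised by the projection with second coordinate
  \<open>e \<cdot> f\<close>.\<close>

lemma sigma_W: "sigma W' = {(x, y). x \<in> carrier W' \<and> y \<in> carrier W' \<and> fst x = fst y}"
proof -
  have "(\<exists>e\<in>proj W'. e \<cdot>\<^bsub>W'\<^esub> x = e \<cdot>\<^bsub>W'\<^esub> y) \<longleftrightarrow> fst x = fst y"
    if xy: "x \<in> carrier W'" "y \<in> carrier W'" for x y
  proof -
    obtain t e where x: "x = (t, act \<alpha> t e)" "t \<in> carrier T" "e \<in> dom (\<alpha> t)"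
      using xy(1) by (rule W_cases)
    obtain u f where y: "y = (u, act \<alpha> u f)" "u \<in> carrier T" "f \<in> dom (\<alpha> u)"
      using xy(2) by (rule W_cases)
    have e: "e \<in> carrier Y" "f \<in> carrier Y" using x y dom_carrier by blast+
    have "(\<one>\<^bsub>T\<^esub>, g) \<cdot>\<^bsub>W'\<^esub> x = (\<one>\<^bsub>T\<^esub>, g) \<cdot>\<^bsub>W'\<^esub> y \<longleftrightarrow> t = u \<and> act \<alpha> t (g \<cdot> e) = act \<alpha> u (g \<cdot> f)"
      if "g \<in> carrier Y" for g
      using x y that by (simp add: W_one_mult)
    moreover have "e \<cdot> f \<cdot> e = e \<cdot> f \<cdot> f" using e by (simp add: ac)
    moreover have "e \<cdot> f \<in> carrier Y" using e by (simp add: closed)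
    ultimately show ?thesis unfolding proj_W x(1) y(1) by force
  qed
  then show ?thesis by (simp add: sigma_def cong: conj_cong)
qed

text \<open>In a \<sigma>-class \<open>t\<close> is fixed; plus reads off \<open>e\<close>, star
  reads off \<open>e^t\<close>, and each of these determines the pair.\<close>

lemma proper_W: "proper W'"
proof -
  have "x = y" if xy: "(x, y) \<in> sigma W'" "rplus W' x = rplus W' y" for x y
  proof -
    have "x \<in> carrier W'" "y \<in> carrier W'" using xy by (simp_all add: sigma_W)
    then obtain t e u f where x: "x = (t, act \<alpha> t e)" "t \<in> carrier T" "e \<in> dom (\<alpha> t)"
      and y: "y = (u, act \<alpha> u f)" "u \<in> carrier T" "f \<in> dom (\<alpha> u)"
      using W_cases[of x] W_cases[of y] by metis
    have "t = u" using xy(1) x y by (simp add: sigma_W)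
    moreover have "e = f"
      using xy(2) unfolding x(1) y(1) W_plus'[OF x(2,3)] W_plus'[OF y(2,3)] by simp
    ultimately show ?thesis using x y by simp
  qed
  then have "R_rel W' \<inter> sigma W' = Id_on (carrier W')"
    by (intro equalityI subrelI) (auto simp: R_rel_def sigma_W Id_on_iff simp del: split_paired_All)
  moreover have "x = y" if "(x, y) \<in> sigma W'" "rstar W' x = rstar W' y" for x y
    using that by (cases x; cases y) (auto simp: sigma_W W_star)
  then have "L_rel W' \<inter> sigma W' = Id_on (carrier W')"
    by (intro equalityI subrelI) (auto simp: L_rel_def sigma_W Id_on_iff simp del: split_paired_All)
  ultimately show ?thesis
    unfolding proper_def using restriction_semigroup_W by blast
qed

lemma fst_W_mult: "fst (x \<cdot>\<^bsub>W'\<^esub> y) = fst x \<otimes>\<^bsub>T\<^esub> fst y"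
  by (simp add: W_def split: prod.split)

lemma perfect_sigma_W: "perfect_congruence W' (sigma W')"
proof -
  interpret W: restriction_semigroup W' by (rule restriction_semigroup_W)
  have "equiv (carrier W') (sigma W')"
    by (auto simp: sigma_W equiv_def refl_on_def sym_def trans_def)
  moreover have "fst (rplus W' x) = \<one>\<^bsub>T\<^esub>" "fst (rstar W' x) = \<one>\<^bsub>T\<^esub>" for x
    by (simp_all add: W_def split: prod.split)
  ultimately have "congruence W' (sigma W')"
    unfolding congruence_def
    by (auto simp: sigma_W fst_W_mult W.closed W.plus_closed W.star_closed simp del: fst_conv)
  moreover have "{x \<cdot>\<^bsub>W'\<^esub> y |x y. x \<in> sigma W' `` {a} \<and> y \<in> sigma W' `` {b}} =
      sigma W' `` {a \<cdot>\<^bsub>W'\<^esub> b}" if a: "a \<in> carrier W'" and b: "b \<in> carrier W'" for a b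
  proof
    show "{x \<cdot>\<^bsub>W'\<^esub> y |x y. x \<in> sigma W' `` {a} \<and> y \<in> sigma W' `` {b}} \<subseteq>
        sigma W' `` {a \<cdot>\<^bsub>W'\<^esub> b}"
      using a b by (auto simp: sigma_W fst_W_mult W.closed simp del: fst_conv)
  next
    have tu: "fst a \<in> carrier T" "fst b \<in> carrier T"
      using a b by (auto simp: carrier_W)
    show "sigma W' `` {a \<cdot>\<^bsub>W'\<^esub> b} \<subseteq>
        {x \<cdot>\<^bsub>W'\<^esub> y |x y. x \<in> sigma W' `` {a} \<and> y \<in> sigma W' `` {b}}"
    proof
      fix z assume "z \<in> sigma W' `` {a \<cdot>\<^bsub>W'\<^esub> b}"
      then have "z \<in> carrier W'" "fst z = fst a \<otimes>\<^bsub>T\<^esub> fst b"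
        by (auto simp: sigma_W fst_W_mult simp del: fst_conv)
      then obtain g where z: "z = (fst a \<otimes>\<^bsub>T\<^esub> fst b, act \<alpha> (fst a \<otimes>\<^bsub>T\<^esub> fst b) g)"
        and g: "g \<in> dom (\<alpha> (fst a \<otimes>\<^bsub>T\<^esub> fst b))"
        by (rule W_cases_fst)
      \<comment> \<open>An element of the product class factorises along its own plus coordinate
        \<open>g\<close>: first \<open>t\<close> acts on \<open>g\<close>, then \<open>u\<close>
        acts on \<open>g^t\<close>. The two factors meet exactly at \<open>g^t\<close>, so nothing
        is cut down in the product.\<close>
      let ?x = "(fst a, act \<alpha> (fst a) g)" and ?y = "(fst b, act \<alpha> (fst b) (act \<alpha> (fst a) g))"
      have g': "g \<in> dom (\<alpha> (fst a))" "act \<alpha> (fst a) g \<in> dom (\<alpha> (fst b))"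
        using g tu by (simp_all add: dom_mult)
      then have "z = ?x \<cdot>\<^bsub>W'\<^esub> ?y"
        using tu by (simp add: z W_mult' act_mult idem act_closed)
      moreover have "?x \<in> sigma W' `` {a}" "?y \<in> sigma W' `` {b}"
        using a b tu g' by (auto simp: sigma_W W_carrierI)
      ultimately show "z \<in> {x \<cdot>\<^bsub>W'\<^esub> y |x y. x \<in> sigma W' `` {a} \<and> y \<in> sigma W' `` {b}}"
        by blast
    qed
  qed
  ultimately show ?thesis by (simp add: perfect_congruence_def)
qed

lemma almost_perfect_W: "almost_perfect W'"
  by (simp add: almost_perfect_def proper_W perfect_sigma_W)

section \<open>Identity and greatest elements in \<open>W\<close>\<close>

lemma is_identity_W:
  assumes "is_identity Y i"
  shows "is_identity W' (\<one>\<^bsub>T\<^esub>, i)"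
proof -
  have i: "i \<in> carrier Y" "\<And>e. e \<in> carrier Y \<Longrightarrow> i \<cdot> e = e \<and> e \<cdot> i = e"
    using assms by (simp_all add: is_identity_def)
  have "(\<one>\<^bsub>T\<^esub>, i) \<cdot>\<^bsub>W'\<^esub> x = x \<and> x \<cdot>\<^bsub>W'\<^esub> (\<one>\<^bsub>T\<^esub>, i) = x" if "x \<in> carrier W'" for x
    using that
  proof (rule W_cases)
    fix t e assume "x = (t, act \<alpha> t e)" "t \<in> carrier T" "e \<in> dom (\<alpha> t)"
    then show ?thesis using i dom_carrier[of t e] by (simp add: W_one_mult W_mult_one act_closed)
  qed
  then show ?thesis by (simp add: is_identity_def W_one_carrier i)
qed

text \<open>The domain of \<alpha> at \<open>t\<close> has a largest element \<open>e\<close>, and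
  \<open>(t, e^t)\<close> is the greatest element of its \<sigma>-class: any \<open>(t, f^t)\<close>
  is its restriction by the projection with second coordinate \<open>f\<close>.\<close>

lemma perfect_W:
  assumes "has_identity Y" "acts_by_principal_ideal_isos T Y \<alpha>"
  shows "perfect W'"
proof -
  have "has_identity W'" using assms(1) is_identity_W by (auto simp: has_identity_def)
  moreover have "\<exists>m. is_greatest W' C m" if C: "C \<in> carrier W' // sigma W'" for C
  proof -
    obtain a where a: "a \<in> carrier W'" "C = sigma W' `` {a}" using C by (auto simp: quotient_def)
    define t where "t = fst a"
    have t: "t \<in> carrier T" using a by (auto simp: carrier_W t_def)
    have "\<alpha> t \<in> munn_semigroup Y"
      using assms(2) t by (auto simp: acts_by_principal_ideal_isos_def)
    then obtain e where "e \<in> carrier Y" "dom (\<alpha> t) = down Y e"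
      by (auto simp: munn_semigroup_def is_principal_ideal_def)
    then have e: "e \<in> dom (\<alpha> t)" "\<And>f. f \<in> dom (\<alpha> t) \<Longrightarrow> f = f \<cdot> e"
      by (auto simp: down_def idem)
    have "natural_le W' x (t, act \<alpha> t e)" if "x \<in> C" for x
    proof -
      have "x \<in> carrier W'" "fst x = t" using that a by (auto simp: sigma_W t_def)
      then obtain f where f: "x = (t, act \<alpha> t f)" "f \<in> dom (\<alpha> t)" by (rule W_cases_fst)
      then have "x = (\<one>\<^bsub>T\<^esub>, f) \<cdot>\<^bsub>W'\<^esub> (t, act \<alpha> t e)"
        using W_one_mult[OF dom_carrier[OF t f(2)] t e(1)] e(2)[OF f(2)] by simp
      then show ?thesis
        unfolding natural_le_def using dom_carrier[OF t f(2)] by (auto simp: proj_W)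
    qed
    moreover have "(t, act \<alpha> t e) \<in> C"
      using a t e by (auto simp: sigma_W t_def W_carrierI)
    ultimately show ?thesis unfolding is_greatest_def by blast
  qed
  ultimately show ?thesis
    by (simp add: perfect_def restriction_monoid_def restriction_semigroup_W proper_W perfect_sigma_W)
qed

end


section \<open>The covering semigroup\<close>

definition word_monoid :: "('a, 'm) restr_scheme \<Rightarrow> 'a list monoid" where
  "word_monoid S = \<lparr>carrier = lists (carrier S), monoid.mult = (@), one = []\<rparr>"

text \<open>The first letter acts first. The empty word acts as the identity map on all
  projections.\<close>

definition word_action :: "('a, 'm) restr_scheme \<Rightarrow> 'a list \<Rightarrow> ('a \<rightharpoonup> 'a)" where
  "word_action S w = foldr (\<lambda>a \<beta>. \<beta> \<circ>\<^sub>m munn S a) w \<one>\<^bsub>TI (proj_semilattice S)\<^esub>"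

text \<open>The final factor \<open>x\<close> gives the empty word a value even though
  \<open>S\<close> may have no identity. In the cover it is the projection coordinate.\<close>

definition word_eval :: "('a, 'm) restr_scheme \<Rightarrow> 'a list \<Rightarrow> 'a \<Rightarrow> 'a" where
  "word_eval S w x = foldr (smult S) w x"

lemma proj_semilattice_simps [simp]:
  "carrier (proj_semilattice S) = proj S" "smult (proj_semilattice S) = smult S"
  by (simp_all add: proj_semilattice_def)

context restriction_semigroup
begin

section \<open>The Munn isomorphisms\<close>

lemma munn_Some:
  assumes "a \<in> carrier S"
  shows "munn S a e = Some f \<longleftrightarrow> e \<in> proj S \<and> e = e \<cdot> rplus S a \<and> f = rstar S (e \<cdot> a)"
  using natural_le_proj[of e "rplus S a"] plus_in_proj[OF assms] by (auto simp: munn_def)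

lemma down_proj: "down (proj_semilattice S) e = {f \<in> proj S. f = f \<cdot> e}"
  by (simp add: down_def)

text \<open>From \<open>e a = a f\<close> one gets \<open>(a f)^+ = (e a)^+ = e a^+ = e\<close>.
  Thus \<open>f\<close> determines \<open>e\<close>, which gives injectivity.\<close>

lemma munn_plus:
  assumes "a \<in> carrier S" "munn S a e = Some f"
  shows "rplus S (a \<cdot> f) = e"
  using assms by (metis munn_Some plus_proj_mult proj_mult)

text \<open>Describes the inverse map: a projection \<open>f\<close> below \<open>a^*\<close> comes
  from \<open>(a f)^+\<close>, because \<open>(a f)^+ a = a f\<close> has star
  \<open>f\<close>.\<close>

lemma munn_eqI:
  assumes "a \<in> carrier S" "f \<in> proj S" "f = f \<cdot> rstar S a"
  shows "munn S a (rplus S (a \<cdot> f)) = Some f"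
proof -
  have af: "a \<cdot> f \<in> carrier S" using assms proj_carrier closed by blast
  have "rplus S (a \<cdot> f) \<cdot> a = a \<cdot> f" using assms mult_proj by simp
  moreover have "rstar S (a \<cdot> f) = f"
    using assms by (metis proj_comm star_in_proj star_mult_proj)
  moreover have "rplus S (a \<cdot> f) = rplus S (a \<cdot> f) \<cdot> rplus S a"
    using assms by (metis plus_comm plus_mult_le proj_carrier af)
  ultimately show ?thesis using assms(1) af by (simp add: munn_Some plus_in_proj)
qed

lemma munn_in_munn_semigroup:
  assumes a: "a \<in> carrier S"
  shows "munn S a \<in> munn_semigroup (proj_semilattice S)"
proof -
  interpret Y: semilattice_algebra "proj_semilattice S" by (rule semilattice_proj)
  have "dom (munn S a) = down (proj_semilattice S) (rplus S a)"
    unfolding down_proj using munn_Some[OF a] by (auto simp: dom_def)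
  then have dom: "is_principal_ideal (proj_semilattice S) (dom (munn S a))"
    using a by (auto simp: is_principal_ideal_def plus_in_proj)
  have "f \<in> down (proj_semilattice S) (rstar S a)" if e: "munn S a e = Some f" for e f
  proof -
    have "e \<in> carrier S" and f: "f = rstar S (e \<cdot> a)"
      using munn_Some[OF a] e proj_carrier by blast+
    then show ?thesis using a by (simp add: down_proj star_in_proj closed star_mult_le)
  qed
  then have "ran (munn S a) = down (proj_semilattice S) (rstar S a)"
    using munn_eqI[OF a] by (fastforce simp: ran_def down_proj)
  then have ran: "is_principal_ideal (proj_semilattice S) (ran (munn S a))"
    using a by (auto simp: is_principal_ideal_def star_in_proj)
  have "munn S a (e \<cdot> f) = Some (x \<cdot> y)"
    if "munn S a e = Some x" "munn S a f = Some y" for e f x y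
  proof -
    have e: "e \<in> proj S" "x = rstar S (e \<cdot> a)" and f: "f \<in> proj S" "f = f \<cdot> rplus S a" "y = rstar S (f \<cdot> a)"
      using that munn_Some[OF a] by blast+
    have c: "e \<in> carrier S" "f \<in> carrier S" using e f proj_carrier by blast+
    have "x \<cdot> y = rstar S ((e \<cdot> a) \<cdot> rstar S (f \<cdot> a))"
      using e f c a by (simp add: star_star closed)
    \<comment> \<open>The ample identity turns \<open>a\<close> times the star of \<open>f a\<close>
      back into \<open>f a\<close>.\<close>
    also have "(e \<cdot> a) \<cdot> rstar S (f \<cdot> a) = (e \<cdot> f) \<cdot> a"
      using c a f by (metis assoc closed proj_mult star_closed)
    finally have "x \<cdot> y = rstar S ((e \<cdot> f) \<cdot> a)" .
    moreover have "e \<cdot> f = (e \<cdot> f) \<cdot> rplus S a" using c a f by (metis assoc plus_closed)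
    ultimately show ?thesis using e f a by (simp add: munn_Some proj_closed)
  qed
  moreover have "e = f" if "munn S a e = Some x" "munn S a f = Some x" for e f x
    using munn_plus[OF a] that by metis
  ultimately have "munn S a \<in> carrier (TI (proj_semilattice S))"
    using dom ran Y.is_principal_ideal_is_ideal
    unfolding Y.TI_carrier_iff proj_semilattice_simps by blast
  then show ?thesis using dom ran by (simp add: munn_semigroup_def)
qed

section \<open>The free monoid acting on projections\<close>

lemma word_action_Nil: "word_action S [] = \<one>\<^bsub>TI (proj_semilattice S)\<^esub>"
  and word_action_Cons: "word_action S (a # w) = word_action S w \<circ>\<^sub>m munn S a"
  by (simp_all add: word_action_def)

lemma word_action_in_TI:
  "w \<in> lists (carrier S) \<Longrightarrow> word_action S w \<in> carrier (TI (proj_semilattice S))"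
proof (induction w)
  interpret Y: semilattice_algebra "proj_semilattice S" by (rule semilattice_proj)
  {
    case Nil
    show ?case using monoid.one_closed[OF Y.monoid_TI] by (simp add: word_action_Nil)
  next
    case (Cons a w)
    then show ?case
      using munn_in_munn_semigroup[of a] Y.TI_mult_closed[of "munn S a"]
      by (simp add: word_action_Cons munn_semigroup_def)
  }
qed

lemma word_action_in_munn_semigroup:
  assumes "has_identity S"
  shows "w \<in> lists (carrier S) \<Longrightarrow> word_action S w \<in> munn_semigroup (proj_semilattice S)"
proof (induction w)
  interpret Y: semilattice_algebra "proj_semilattice S" by (rule semilattice_proj)
  {
    case Nil
    show ?case
      using Y.TI_one_in_munn_semigroup has_identity_proj assms by (simp add: word_action_Nil)
  next
    case (Cons a w)
    then show ?case
      using munn_in_munn_semigroup[of a] Y.munn_semigroup_mult_closed[of "munn S a"]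
      by (simp add: word_action_Cons)
  }
qed

lemma word_action_append:
  assumes "v \<in> lists (carrier S)"
  shows "word_action S (w @ v) = word_action S v \<circ>\<^sub>m word_action S w"
proof (induction w)
  interpret Y: semilattice_algebra "proj_semilattice S" by (rule semilattice_proj)
  case Nil
  show ?case
    using monoid.l_one[OF Y.monoid_TI word_action_in_TI[OF assms]]
    by (simp add: word_action_Nil Y.TI_mult)
next
  case (Cons a w)
  then show ?case
    by (auto simp: word_action_Cons map_comp_def fun_eq_iff split: option.splits)
qed

lemma monoid_word_monoid: "monoid (word_monoid S)"
  by unfold_locales (auto simp: word_monoid_def)

lemma acts_word_action:
  "acts_by_ideal_isos (word_monoid S) (proj_semilattice S) (word_action S)"
proof -
  interpret Y: semilattice_algebra "proj_semilattice S" by (rule semilattice_proj)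
  show ?thesis
    unfolding acts_by_ideal_isos_def hom_def
    by (auto simp: word_monoid_def word_action_in_TI word_action_append Y.TI_mult word_action_Nil)
qed

section \<open>Evaluating words in \<open>S\<close>\<close>

lemma word_eval_simps [simp]:
  "word_eval S [] x = x" "word_eval S (a # w) x = a \<cdot> word_eval S w x"
  "word_eval S (w @ v) x = word_eval S w (word_eval S v x)"
  by (simp_all add: word_eval_def)

lemma word_eval_closed:
  "\<lbrakk>w \<in> lists (carrier S); x \<in> carrier S\<rbrakk> \<Longrightarrow> word_eval S w x \<in> carrier S"
  by (induction w) (auto simp: closed)

lemma word_eval_mult:
  "\<lbrakk>w \<in> lists (carrier S); x \<in> carrier S; y \<in> carrier S\<rbrakk>
    \<Longrightarrow> word_eval S w x \<cdot> y = word_eval S w (x \<cdot> y)"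
  by (induction w) (auto simp: word_eval_closed assoc)

lemma word_action_proj:
  assumes "w \<in> lists (carrier S)" "word_action S w e = Some f"
  shows "e \<in> proj S" "f \<in> proj S"
proof -
  interpret Y: semilattice_algebra "proj_semilattice S" by (rule semilattice_proj)
  show "e \<in> proj S" "f \<in> proj S"
    using Y.TI_dom_carrier Y.TI_ran_carrier word_action_in_TI[OF assms(1)] assms(2) by auto
qed

text \<open>Unfolds the first letter for the inductions below. Here \<open>g\<close> is the image of
  \<open>e\<close> under the Munn isomorphism of \<open>a\<close>, and \<open>e a = a g\<close>
  carries the restriction across that letter.\<close>

lemma word_action_Cons_Some:
  assumes "a # w \<in> lists (carrier S)" "word_action S (a # w) e = Some f"
  defines "g \<equiv> rstar S (e \<cdot> a)"
  shows "word_action S w g = Some f" "e \<in> proj S" "g \<in> proj S" "e \<cdot> rplus S a = e"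
    "e \<cdot> a = a \<cdot> g" "a \<in> carrier S" "word_eval S w f \<in> carrier S"
proof -
  show a: "a \<in> carrier S" using assms(1) by simp
  obtain g' where g': "munn S a e = Some g'" "word_action S w g' = Some f"
    using assms(2) by (auto simp: word_action_Cons map_comp_Some_iff)
  have e: "e \<in> proj S" "e = e \<cdot> rplus S a" "g' = g"
    using g'(1) munn_Some[OF a] by (auto simp: g_def)
  show "e \<in> proj S" by (rule e(1))
  show "e \<cdot> rplus S a = e" using e(2) by (rule sym)
  show "word_action S w g = Some f" using g'(2) e(3) by simp
  moreover have w: "w \<in> lists (carrier S)" using assms(1) by simp
  ultimately have "f \<in> proj S" and "g \<in> proj S" using word_action_proj by blast+
  then show "g \<in> proj S" "word_eval S w f \<in> carrier S"
    using w word_eval_closed proj_carrier by blast+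
  show "e \<cdot> a = a \<cdot> g" unfolding g_def using e(1) a by (rule proj_mult)
qed

text \<open>If the rest of the word evaluates to \<open>x\<close> with \<open>x^+ = g\<close>, then
  \<open>(a x)^+ = (a g)^+ = (e a)^+ = e a^+ = e\<close>.\<close>

lemma word_eval_plus:
  "\<lbrakk>w \<in> lists (carrier S); word_action S w e = Some f\<rbrakk> \<Longrightarrow> rplus S (word_eval S w f) = e"
proof (induction w arbitrary: e)
  interpret Y: semilattice_algebra "proj_semilattice S" by (rule semilattice_proj)
  case Nil
  then show ?case by (auto simp: word_action_Nil Y.TI_one proj_plus split: if_splits)
next
  case (Cons a w)
  define g where "g = rstar S (e \<cdot> a)"
  note g = word_action_Cons_Some[OF Cons.prems, folded g_def]
  have "rplus S (word_eval S w f) = g" using Cons g by auto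
  then have "rplus S (a \<cdot> word_eval S w f) = rplus S (e \<cdot> a)"
    using g by (metis plus_mult)
  also have "\<dots> = e" using g by (metis plus_proj_mult)
  finally show ?case by simp
qed

text \<open>The value \<open>x\<close> of the remaining word satisfies \<open>g x = x\<close> with
  \<open>g\<close> below \<open>a^*\<close>, so \<open>a^* x = x\<close>. Hence prefixing
  \<open>a\<close> leaves the star unchanged.\<close>

lemma word_eval_star:
  "\<lbrakk>w \<in> lists (carrier S); word_action S w e = Some f\<rbrakk> \<Longrightarrow> rstar S (word_eval S w f) = f"
proof (induction w arbitrary: e)
  interpret Y: semilattice_algebra "proj_semilattice S" by (rule semilattice_proj)
  case Nil
  then show ?case by (auto simp: word_action_Nil Y.TI_one proj_star split: if_splits)
next
  case (Cons a w)
  define g where "g = rstar S (e \<cdot> a)"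
  note g = word_action_Cons_Some[OF Cons.prems, folded g_def]
  have c: "e \<in> carrier S" "g \<in> carrier S" using g proj_carrier by blast+
  let ?x = "word_eval S w f"
  have "rplus S ?x = g" using word_eval_plus Cons.prems g by simp
  then have "?x = g \<cdot> ?x" using plus_left[OF g(7)] by simp
  moreover have "rstar S a \<cdot> g = g"
    unfolding g_def using star_mult_le[OF c(1) g(6)] star_comm[of a "e \<cdot> a"] g(6) c(1)
    by (simp add: closed star_comm)
  ultimately have "rstar S a \<cdot> ?x = ?x" using g c by (metis assoc star_closed)
  then have "rstar S (a \<cdot> ?x) = rstar S ?x" using star_mult[OF g(6,7)] by simp
  then show ?case using Cons g by simp
qed

text \<open>Restricting the input of a word by \<open>k\<close> amounts to multiplying its value by
  \<open>k\<close> on the left. This is what makes the covering map multiplicative.\<close>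

lemma word_eval_proj_mult:
  "\<lbrakk>w \<in> lists (carrier S); word_action S w e = Some f; k \<in> proj S; word_action S w (k \<cdot> e) = Some f'\<rbrakk>
    \<Longrightarrow> word_eval S w f' = k \<cdot> word_eval S w f"
proof (induction w arbitrary: e k)
  interpret Y: semilattice_algebra "proj_semilattice S" by (rule semilattice_proj)
  case Nil
  then show ?case by (auto simp: word_action_Nil Y.TI_one split: if_splits)
next
  case (Cons a w)
  define g g' where "g = rstar S (e \<cdot> a)" and "g' = rstar S (k \<cdot> e \<cdot> a)"
  note g = word_action_Cons_Some[OF Cons.prems(1,2), folded g_def]
  note g' = word_action_Cons_Some[OF Cons.prems(1,4), folded g'_def]
  have c: "e \<in> carrier S" "g \<in> carrier S" "g' \<in> carrier S" "k \<in> carrier S"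
    using g g' Cons.prems(3) proj_carrier by blast+
  let ?x = "word_eval S w f"
  have "rplus S ?x = g" using word_eval_plus Cons.prems g by simp
  then have x: "g \<cdot> ?x = ?x" using plus_left[OF g(7)] by simp
  \<comment> \<open>After the first letter the restricted input \<open>g'\<close> still lies below
    \<open>g\<close>, so the induction hypothesis applies with \<open>g'\<close> in the role of
    \<open>k\<close>.\<close>
  have "g' \<cdot> g = g'"
    unfolding g_def g'_def assoc[OF c(4,1) g(6)] using c g(6) star_mult_le by (simp add: closed)
  then have "word_action S w (g' \<cdot> g) = Some f'" using g'(1) by simp
  then have "word_eval S w f' = g' \<cdot> ?x"
    using Cons.IH[OF _ g(1) g'(3)] Cons.prems(1) by simp
  then have "a \<cdot> word_eval S w f' = (a \<cdot> g') \<cdot> ?x" using g c by (simp add: assoc)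
  also have "a \<cdot> g' = k \<cdot> (a \<cdot> g)" using g'(5) g(5) assoc[OF c(4,1) g(6)] by simp
  also have "k \<cdot> (a \<cdot> g) \<cdot> ?x = k \<cdot> (a \<cdot> (g \<cdot> ?x))" using g(6,7) c by (simp add: assoc closed)
  finally show ?case by (simp add: x)
qed

section \<open>The covering homomorphism\<close>

abbreviation cover :: "('a list \<times> 'a) restr" where
  "cover \<equiv> W (word_monoid S) (proj_semilattice S) (word_action S)"

abbreviation cover_map :: "'a list \<times> 'a \<Rightarrow> 'a" where
  "cover_map \<equiv> \<lambda>(w, f). word_eval S w f"

lemma ideal_action_word_action:
  "ideal_action (word_monoid S) (proj_semilattice S) (word_action S)"
  by (simp add: ideal_action_def ideal_action_axioms_def monoid_word_monoid semilattice_proj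
      acts_word_action)

lemma covers_via_cover_map: "covers_via cover S cover_map"
proof -
  interpret A: ideal_action "word_monoid S" "proj_semilattice S" "word_action S"
    by (rule ideal_action_word_action)
  have wm: "carrier (word_monoid S) = lists (carrier S)" "\<one>\<^bsub>word_monoid S\<^esub> = []"
    "w \<otimes>\<^bsub>word_monoid S\<^esub> v = w @ v" for w v
    by (simp_all add: word_monoid_def)
  have eval: "word_eval S w (act (word_action S) w (k \<cdot> e)) =
      k \<cdot> word_eval S w (act (word_action S) w e)"
    if "w \<in> lists (carrier S)" "e \<in> dom (word_action S w)" "k \<in> proj S" for w e k
  proof -
    have "k \<cdot> e \<in> dom (word_action S w)" using A.dom_meet' that by (simp add: wm)
    then show ?thesis
      using that word_eval_proj_mult[of w e _ k] by (auto simp: act_def)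
  qed
  have cases: "\<exists>w e. x = (w, act (word_action S) w e) \<and> w \<in> lists (carrier S) \<and> e \<in> dom (word_action S w)"
    if "x \<in> carrier cover" for x
    using A.W_cases[OF that] unfolding wm by blast
  have img: "cover_map x \<in> carrier S" if x: "x \<in> carrier cover" for x
  proof -
    obtain w e where x: "x = (w, act (word_action S) w e)" "w \<in> lists (carrier S)" "e \<in> dom (word_action S w)"
      using cases[OF x] by blast
    then have "act (word_action S) w e \<in> proj S" using A.act_closed by (simp add: wm)
    then show ?thesis using x word_eval_closed proj_carrier by simp
  qed
  have mult: "cover_map (x \<cdot>\<^bsub>cover\<^esub> y) = cover_map x \<cdot> cover_map y"
    if xy: "x \<in> carrier cover" "y \<in> carrier cover" for x y
  proof -
    obtain w e where x: "x = (w, act (word_action S) w e)" "w \<in> lists (carrier S)" "e \<in> dom (word_action S w)"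
      using cases[OF xy(1)] by blast
    obtain v h where v: "y = (v, act (word_action S) v h)" "v \<in> lists (carrier S)" "h \<in> dom (word_action S v)"
      using cases[OF xy(2)] by blast
    have f: "act (word_action S) w e \<in> proj S" using x A.act_closed by (simp add: wm)
    \<comment> \<open>In the product the word \<open>v\<close> acts on \<open>h\<close> restricted
      by the second coordinate of \<open>x\<close>; \<open>eval\<close> turns this restriction into
      a left factor of the value of \<open>v\<close>.\<close>
    have "cover_map (x \<cdot>\<^bsub>cover\<^esub> y) = word_eval S w (act (word_action S) w e \<cdot> cover_map y)"
      unfolding x(1) v(1) using x v f by (simp add: A.W_mult' wm eval)
    also have "\<dots> = cover_map x \<cdot> cover_map y"
      using x f img[OF xy(2)] by (simp add: word_eval_mult proj_carrier)
    finally show ?thesis .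
  qed
  have plus_star: "cover_map (rplus cover x) = rplus S (cover_map x) \<and>
      cover_map (rstar cover x) = rstar S (cover_map x)"
    if x: "x \<in> carrier cover" for x
  proof -
    obtain w e where x: "x = (w, act (word_action S) w e)" "w \<in> lists (carrier S)" "e \<in> dom (word_action S w)"
      using cases[OF x] by blast
    then have "word_action S w e = Some (act (word_action S) w e)" by (auto simp: act_def)
    then show ?thesis
      using x word_eval_plus word_eval_star by (simp add: A.W_plus' W_star wm)
  qed
  have "a \<in> cover_map ` carrier cover" if a: "a \<in> carrier S" for a
  proof -
    \<comment> \<open>A preimage of \<open>a\<close> is the one-letter word paired with
      \<open>a^*\<close>, which evaluates to \<open>a a^* = a\<close>.\<close>
    have "word_action S [a] (rplus S a) = Some (rstar S a)"
      using a by (auto simp: word_action_Cons word_action_Nil map_comp_Some_iff munn_Some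
          plus_in_proj plus_left proj_idem A.TI_one star_in_proj)
    then have "([a], rstar S a) \<in> carrier cover"
      using a by (auto simp: carrier_W wm ran_def)
    then show ?thesis using a by (force simp: star_right)
  qed
  \<comment> \<open>A projection of the cover is the empty word paired with a projection of
    \<open>S\<close>, and its value is that projection.\<close>
  moreover have "inj_on cover_map (proj cover)"
    by (auto simp: inj_on_def A.proj_W wm)
  ultimately show ?thesis
    unfolding covers_via_def restr_hom_def using img mult plus_star A.proper_W by blast
qed

lemma almost_perfect_cover: "almost_perfect cover \<and> is_cover cover S"
  using covers_via_cover_map ideal_action.almost_perfect_W[OF ideal_action_word_action]
  by (auto simp: is_cover_def)

lemma perfect_monoidal_cover:
  assumes "has_identity S"
  shows "perfect cover \<and> is_monoidal_cover cover S"
proof -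
  interpret A: ideal_action "word_monoid S" "proj_semilattice S" "word_action S"
    by (rule ideal_action_word_action)
  \<comment> \<open>The identity of \<open>S\<close> is what puts the action of the empty word, the
    identity map on projections, into the Munn semigroup.\<close>
  have "acts_by_principal_ideal_isos (word_monoid S) (proj_semilattice S) (word_action S)"
    using word_action_in_munn_semigroup[OF assms]
    by (simp add: acts_by_principal_ideal_isos_def acts_word_action) (simp add: word_monoid_def)
  then have perf: "perfect cover" using A.perfect_W has_identity_proj assms by blast
  obtain i where i: "is_identity S i" using assms by (auto simp: has_identity_def)
  have ip: "i \<in> proj S" by (rule identity_in_proj[OF i])
  then have "is_identity (proj_semilattice S) i"
    using i proj_carrier by (simp add: is_identity_def)
  then have "is_identity cover ([], i)"
    using A.is_identity_W by (simp add: word_monoid_def)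
  \<comment> \<open>An identity is unique, so it suffices to evaluate \<open>([], i)\<close>, whose
    value is \<open>i\<close>.\<close>
  then have "e = ([], i)" if "is_identity cover e" for e using that by (rule identity_unique[rotated])
  then have "preserves_identity cover S cover_map"
    using i by (fastforce simp: preserves_identity_def)
  then show ?thesis
    using perf covers_via_cover_map restriction_semigroup_axioms assms
    unfolding is_monoidal_cover_def restriction_monoid_def perfect_def by blast
qed

end


section \<open>Almost perfect restriction semigroups\<close>

text \<open>The map whose graph pairs \<open>a^+\<close> with \<open>a^*\<close> for
  \<open>a\<close> in the class. The choice is arbitrary in general; in a proper semigroup at most
  one \<open>a\<close> in a \<sigma>-class has a given plus.\<close>

definition sigma_action :: "('a, 'm) restr_scheme \<Rightarrow> 'a set \<Rightarrow> ('a \<rightharpoonup> 'a)" where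
  "sigma_action S C = (\<lambda>e. if \<exists>a\<in>C. rplus S a = e
     then Some (rstar S (SOME a. a \<in> C \<and> rplus S a = e)) else None)"

locale almost_perfect_semigroup = restriction_semigroup +
  assumes almost_perfect: "almost_perfect S"
begin

section \<open>Consequences of properness for \<sigma>\<close>

lemma equiv_sigma: "equiv (carrier S) (sigma S)"
  and sigma_mult: "\<lbrakk>(a, a') \<in> sigma S; (b, b') \<in> sigma S\<rbrakk> \<Longrightarrow> (a \<cdot> b, a' \<cdot> b') \<in> sigma S"
  and sigma_perfect: "\<lbrakk>a \<in> carrier S; b \<in> carrier S\<rbrakk> \<Longrightarrow>
    {x \<cdot> y |x y. x \<in> sigma S `` {a} \<and> y \<in> sigma S `` {b}} = sigma S `` {a \<cdot> b}"
  using almost_perfect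
  unfolding almost_perfect_def perfect_congruence_def congruence_def by blast+

lemma sigma_carrier: "(a, b) \<in> sigma S \<Longrightarrow> a \<in> carrier S \<and> b \<in> carrier S"
  by (simp add: sigma_def)

lemma sigma_sym: "(a, b) \<in> sigma S \<Longrightarrow> (b, a) \<in> sigma S"
  by (auto simp: sigma_def intro: sym)

lemma sigma_plus_eq:
  assumes "(a, b) \<in> sigma S" "rplus S a = rplus S b"
  shows "a = b"
proof -
  have "(a, b) \<in> R_rel S \<inter> sigma S" using assms sigma_carrier by (auto simp: R_rel_def)
  also have "\<dots> = Id_on (carrier S)"
    using almost_perfect by (simp add: almost_perfect_def proper_def)
  finally show ?thesis by (simp add: Id_on_iff)
qed

lemma sigma_star_eq:
  assumes "(a, b) \<in> sigma S" "rstar S a = rstar S b"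
  shows "a = b"
proof -
  have "(a, b) \<in> L_rel S \<inter> sigma S" using assms sigma_carrier by (auto simp: L_rel_def)
  also have "\<dots> = Id_on (carrier S)"
    using almost_perfect by (simp add: almost_perfect_def proper_def)
  finally show ?thesis by (simp add: Id_on_iff)
qed

lemma proj_mult_sigma:
  assumes "e \<in> proj S" "a \<in> carrier S"
  shows "(e \<cdot> a, a) \<in> sigma S"
proof -
  have "e \<cdot> (e \<cdot> a) = e \<cdot> a" using assms by (metis assoc proj_carrier proj_idem)
  then show ?thesis using assms closed proj_carrier by (auto simp: sigma_def)
qed

lemma mult_proj_sigma:
  assumes "e \<in> proj S" "a \<in> carrier S"
  shows "(a \<cdot> e, a) \<in> sigma S"
proof -
  have "rplus S (a \<cdot> e) \<in> proj S" using assms by (simp add: plus_in_proj closed proj_carrier)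
  then show ?thesis using proj_mult_sigma[of "rplus S (a \<cdot> e)" a] mult_proj assms by simp
qed

section \<open>The partial isomorphism given by one \<sigma>-class\<close>

context
  fixes C assumes C: "C \<in> carrier S // sigma S"
begin

lemma class_carrier: "a \<in> C \<Longrightarrow> a \<in> carrier S"
  using in_quotient_imp_subset[OF equiv_sigma C] by blast

lemma class_sigma: "\<lbrakk>a \<in> C; b \<in> C\<rbrakk> \<Longrightarrow> (a, b) \<in> sigma S"
  using in_quotient_imp_in_rel[OF equiv_sigma C, of a b] by simp

lemma class_closed: "\<lbrakk>a \<in> C; (a, b) \<in> sigma S\<rbrakk> \<Longrightarrow> b \<in> C"
  using in_quotient_imp_closed[OF equiv_sigma C] .

lemma class_eq: "a \<in> C \<Longrightarrow> C = sigma S `` {a}"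
  using class_sigma class_closed by blast

lemma class_nonempty: "\<exists>a. a \<in> C"
  using in_quotient_imp_non_empty[OF equiv_sigma C] by blast

lemma class_proj_mult: "\<lbrakk>a \<in> C; e \<in> proj S\<rbrakk> \<Longrightarrow> e \<cdot> a \<in> C"
  using class_closed[OF _ sigma_sym[OF proj_mult_sigma]] class_carrier by blast

lemma class_mult_proj: "\<lbrakk>a \<in> C; e \<in> proj S\<rbrakk> \<Longrightarrow> a \<cdot> e \<in> C"
  using class_closed[OF _ sigma_sym[OF mult_proj_sigma]] class_carrier by blast

lemma class_plus_eq: "\<lbrakk>a \<in> C; b \<in> C; rplus S a = rplus S b\<rbrakk> \<Longrightarrow> a = b"
  by (rule sigma_plus_eq[OF class_sigma])

lemma class_star_eq: "\<lbrakk>a \<in> C; b \<in> C; rstar S a = rstar S b\<rbrakk> \<Longrightarrow> a = b"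
  by (rule sigma_star_eq[OF class_sigma])

lemma sigma_action_Some:
  "sigma_action S C e = Some f \<longleftrightarrow> (\<exists>a\<in>C. e = rplus S a \<and> f = rstar S a)"
proof -
  have "(SOME b. b \<in> C \<and> rplus S b = rplus S a) = a" if "a \<in> C" for a
  proof (rule some_equality)
    show "a \<in> C \<and> rplus S a = rplus S a" using that by simp
    show "b = a" if "b \<in> C \<and> rplus S b = rplus S a" for b
      using that \<open>a \<in> C\<close> class_plus_eq[of b a] by simp
  qed
  then show ?thesis by (auto simp: sigma_action_def)
qed

text \<open>Two common restrictions of \<open>a\<close> and \<open>b\<close> are compared:
  \<open>?c\<close> has plus \<open>a^+ b^+\<close> and \<open>?d\<close> has star
  \<open>a^* b^*\<close>. Their stars turn out to be equal, so \<open>?c\<close> carries the meet of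
  the pluses to the meet of the stars.\<close>

lemma sigma_action_meet:
  assumes a: "a \<in> C" and b: "b \<in> C"
  shows "sigma_action S C (rplus S a \<cdot> rplus S b) = Some (rstar S a \<cdot> rstar S b)"
proof -
  have ac: "a \<in> carrier S" and bc: "b \<in> carrier S" using a b class_carrier by auto
  have pa: "rplus S a \<in> proj S" "rstar S a \<in> proj S" "rplus S b \<in> proj S" "rstar S b \<in> proj S"
    using ac bc plus_in_proj star_in_proj by auto
  have pc: "rplus S a \<in> carrier S" "rstar S a \<in> carrier S" "rplus S b \<in> carrier S" "rstar S b \<in> carrier S"
    using pa proj_carrier by auto
  let ?c = "rplus S a \<cdot> b" and ?d = "a \<cdot> rstar S b"
  have c: "?c \<in> C" "rplus S b \<cdot> a \<in> C" and d: "?d \<in> C" "b \<cdot> rstar S a \<in> C"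
    using a b pa class_proj_mult class_mult_proj by auto
  \<comment> \<open>Both products lie in \<open>C\<close> and have plus \<open>a^+ b^+\<close>, so
    properness identifies them; the next claim does the same with stars.\<close>
  have c_eq: "?c = rplus S b \<cdot> a"
    using plus_plus[OF ac bc] plus_plus[OF bc ac] plus_comm[OF ac bc] class_plus_eq[OF c] by simp
  have d_eq: "?d = b \<cdot> rstar S a"
    using star_star[OF ac bc] star_star[OF bc ac] star_comm[OF ac bc] class_star_eq[OF d] by simp
  have cc: "?c \<in> carrier S" and dc: "?d \<in> carrier S" using c d class_carrier by auto
  have ca: "rstar S ?c \<cdot> rstar S a = rstar S ?c"
    unfolding c_eq using star_mult_le[OF pc(3) ac] .
  have cb: "rstar S ?c \<cdot> rstar S b = rstar S ?c"
    using star_mult_le[OF pc(1) bc] .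
  let ?g = "rplus S ?d"
  have g: "?g \<in> carrier S" using dc plus_closed by simp
  have da: "?d = ?g \<cdot> a" using mult_proj[OF pa(4) ac] .
  have "?g \<cdot> b = ?d" using mult_proj[OF pa(2) bc] d_eq by simp
  \<comment> \<open>Since \<open>?g\<close> fixes \<open>?d = ?g \<cdot> b\<close>, it lies below
    \<open>b^+\<close>. Hence \<open>?d\<close> is a restriction of \<open>?c\<close>, and its star
    lies below the star of \<open>?c\<close>.\<close>
  then have "?g \<cdot> rplus S b = ?g"
    using plus_plus[OF dc bc] by simp
  then have "?d = ?g \<cdot> ?c"
    using da assoc[OF g pc(3) ac] unfolding c_eq by simp
  then have dsc: "rstar S ?d \<cdot> rstar S ?c = rstar S ?d"
    using star_mult_le[OF g cc] by simp
  have ds: "rstar S ?d = rstar S a \<cdot> rstar S b" using star_star[OF bc ac] .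
  have cs: "rstar S ?c \<in> carrier S" using cc star_closed by simp
  \<comment> \<open>The reverse inequality: the star of \<open>?c\<close> lies below both
    \<open>a^*\<close> and \<open>b^*\<close>, whose meet is the star of \<open>?d\<close>.\<close>
  have "rstar S ?c \<cdot> rstar S ?d = rstar S ?c"
    unfolding ds assoc[OF cs pc(2,4), symmetric] ca cb ..
  then have "rstar S a \<cdot> rstar S b = rstar S ?c"
    using dsc star_comm[OF cc dc] ds by simp
  moreover have "rplus S ?c = rplus S a \<cdot> rplus S b" using ac bc by (rule plus_plus)
  ultimately show ?thesis using c(1) by (metis sigma_action_Some)
qed

text \<open>The domain and range consist of the pluses and the stars of elements of
  \<open>C\<close>. They are ideals because \<open>C\<close> is closed under multiplication by
  projections on either side; injectivity is properness for stars.\<close>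

lemma sigma_action_in_TI: "sigma_action S C \<in> carrier (TI (proj_semilattice S))"
proof -
  interpret Y: semilattice_algebra "proj_semilattice S" by (rule semilattice_proj)
  have "dom (sigma_action S C) = rplus S ` C" and ran: "ran (sigma_action S C) = rstar S ` C"
    by (auto simp: dom_def ran_def sigma_action_Some)
  moreover have "rplus S a \<cdot> f \<in> rplus S ` C" "rstar S a \<cdot> f \<in> rstar S ` C"
    if "a \<in> C" "f \<in> proj S" for a f
  proof -
    have "a \<in> carrier S" "rplus S a \<in> proj S" using that class_carrier plus_in_proj by auto
    then have "rplus S a \<cdot> f = rplus S (f \<cdot> a)" "rstar S a \<cdot> f = rstar S (a \<cdot> f)"
      using that by (simp_all add: plus_proj_mult star_mult_proj proj_comm)
    then show "rplus S a \<cdot> f \<in> rplus S ` C" "rstar S a \<cdot> f \<in> rstar S ` C"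
      using that class_proj_mult class_mult_proj by auto
  qed
  ultimately have "is_ideal (proj_semilattice S) (dom (sigma_action S C))"
    "is_ideal (proj_semilattice S) (ran (sigma_action S C))"
    unfolding Y.is_ideal_iff using class_nonempty class_carrier plus_in_proj star_in_proj by auto
  moreover have "e = f" if "sigma_action S C e = Some x" "sigma_action S C f = Some x" for e f x
    using that class_star_eq by (auto simp: sigma_action_Some)
  moreover have "sigma_action S C (e \<cdot> f) = Some (x \<cdot> y)"
    if "sigma_action S C e = Some x" "sigma_action S C f = Some y" for e f x y
    using that sigma_action_meet sigma_action_Some by metis
  ultimately show ?thesis unfolding Y.TI_carrier_iff proj_semilattice_simps by blast
qed

end

section \<open>The quotient monoid and its action\<close>

lemma sigma_class:
  assumes "a \<in> carrier S"
  shows "sigma S `` {a} \<in> carrier S // sigma S" "a \<in> sigma S `` {a}"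
  using quotientI[OF assms] equiv_class_self[OF equiv_sigma assms] .

text \<open>Perfectness says that the set of products is already a class, so saturating it adds
  nothing.\<close>

lemma sigma_quotient_mult:
  assumes "a \<in> carrier S" "b \<in> carrier S"
  shows "sigma S `` {a} \<otimes>\<^bsub>sigma_quotient S\<^esub> sigma S `` {b} = sigma S `` {a \<cdot> b}"
proof -
  have "sigma S `` (sigma S `` {a \<cdot> b}) = sigma S `` {a \<cdot> b}"
    using sigma_class(2) class_closed[OF sigma_class(1)] closed[OF assms] by blast
  then show ?thesis using sigma_perfect[OF assms] by (simp add: sigma_quotient_def)
qed

lemma sigma_quotient_carrier: "carrier (sigma_quotient S) = carrier S // sigma S"
  by (simp add: sigma_quotient_def)

lemma class_cases:
  assumes "C \<in> carrier (sigma_quotient S)"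
  obtains a where "a \<in> carrier S" "C = sigma S `` {a}"
  using assms by (auto simp: sigma_quotient_carrier quotient_def)

text \<open>Any two projections are equalised by their meet. Conversely, an element \<open>a\<close>
  related to a projection is related to \<open>a^+\<close>, which has the same plus, so properness
  gives \<open>a = a^+\<close>.\<close>

lemma sigma_quotient_one: "\<one>\<^bsub>sigma_quotient S\<^esub> = proj S"
  and proj_class: "e \<in> proj S \<Longrightarrow> sigma S `` {e} = proj S"
proof -
  have "a \<in> proj S" if e: "e \<in> proj S" and s: "(e, a) \<in> sigma S" for e a
  proof -
    have a: "a \<in> carrier S" using s sigma_carrier by simp
    obtain f where f: "f \<in> proj S" "f \<cdot> e = f \<cdot> a" using s by (auto simp: sigma_def)
    \<comment> \<open>Both sides equal \<open>f e\<close>, which is \<open>f a\<close> and, on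
      taking pluses, also \<open>f a^+\<close>.\<close>
    then have "(f \<cdot> e) \<cdot> a = (f \<cdot> e) \<cdot> rplus S a"
      using e a by (metis assoc plus_in_proj proj_carrier proj_closed proj_plus plus_proj_mult proj_comm)
    moreover have "f \<cdot> e \<in> proj S" using f(1) e by (rule proj_closed)
    ultimately have "(a, rplus S a) \<in> sigma S"
      using a plus_closed[OF a] unfolding sigma_def by blast
    then have "a = rplus S a" using a by (simp add: sigma_plus_eq plus_in_proj proj_plus)
    then show ?thesis using a by (metis plus_in_proj)
  qed
  moreover have "(e, f) \<in> sigma S" if "e \<in> proj S" "f \<in> proj S" for e f
  proof -
    have "(e \<cdot> f) \<cdot> e = (e \<cdot> f) \<cdot> f"
      using that by (metis assoc proj_carrier proj_comm proj_idem)
    then show ?thesis using that proj_carrier proj_closed by (auto simp: sigma_def)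
  qed
  ultimately show *: "e \<in> proj S \<Longrightarrow> sigma S `` {e} = proj S" for e by blast
  then show "\<one>\<^bsub>sigma_quotient S\<^esub> = proj S" by (auto simp: sigma_quotient_def)
qed

lemma monoid_sigma_quotient: "monoid (sigma_quotient S)"
proof
  obtain e where e: "e \<in> proj S" using nonempty plus_in_proj by blast
  show "\<one>\<^bsub>sigma_quotient S\<^esub> \<in> carrier (sigma_quotient S)"
    using sigma_class[OF proj_carrier[OF e]] proj_class[OF e]
    by (simp add: sigma_quotient_one sigma_quotient_carrier)
  fix A assume "A \<in> carrier (sigma_quotient S)"
  then obtain a where a: "a \<in> carrier S" "A = sigma S `` {a}" by (rule class_cases)
  \<comment> \<open>The identity class is represented by \<open>a^+\<close> on the left of
    \<open>a\<close> and by \<open>a^*\<close> on the right, where each acts trivially.\<close>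
  have p: "rplus S a \<in> proj S" "rstar S a \<in> proj S" using a plus_in_proj star_in_proj by auto
  show "\<one>\<^bsub>sigma_quotient S\<^esub> \<otimes>\<^bsub>sigma_quotient S\<^esub> A = A"
    using sigma_quotient_mult[OF proj_carrier[OF p(1)] a(1)]
    by (simp add: a sigma_quotient_one proj_class[OF p(1)] plus_left)
  show "A \<otimes>\<^bsub>sigma_quotient S\<^esub> \<one>\<^bsub>sigma_quotient S\<^esub> = A"
    using sigma_quotient_mult[OF a(1) proj_carrier[OF p(2)]]
    by (simp add: a sigma_quotient_one proj_class[OF p(2)] star_right)
next
  fix A B assume "A \<in> carrier (sigma_quotient S)" "B \<in> carrier (sigma_quotient S)"
  then obtain a b where a: "a \<in> carrier S" "A = sigma S `` {a}" and b: "b \<in> carrier S" "B = sigma S `` {b}"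
    by (metis class_cases)
  show "A \<otimes>\<^bsub>sigma_quotient S\<^esub> B \<in> carrier (sigma_quotient S)"
    using a b by (simp add: sigma_quotient_mult sigma_quotient_carrier sigma_class closed)
  fix D assume "D \<in> carrier (sigma_quotient S)"
  then obtain d where "d \<in> carrier S" "D = sigma S `` {d}" by (rule class_cases)
  then show "A \<otimes>\<^bsub>sigma_quotient S\<^esub> B \<otimes>\<^bsub>sigma_quotient S\<^esub> D =
      A \<otimes>\<^bsub>sigma_quotient S\<^esub> (B \<otimes>\<^bsub>sigma_quotient S\<^esub> D)"
    using a b by (simp add: sigma_quotient_mult closed assoc)
qed

lemma sigma_action_mult:
  assumes "a \<in> carrier S" "b \<in> carrier S"
  shows "sigma_action S (sigma S `` {a \<cdot> b}) =
    sigma_action S (sigma S `` {b}) \<circ>\<^sub>m sigma_action S (sigma S `` {a})"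
proof -
  note A = sigma_class[OF assms(1)] and B = sigma_class[OF assms(2)]
    and AB = sigma_class[OF closed[OF assms]]
  have "sigma_action S (sigma S `` {a \<cdot> b}) e = Some f \<longleftrightarrow>
      (sigma_action S (sigma S `` {b}) \<circ>\<^sub>m sigma_action S (sigma S `` {a})) e = Some f" for e f
  proof
    assume "sigma_action S (sigma S `` {a \<cdot> b}) e = Some f"
    then obtain c where c: "c \<in> sigma S `` {a \<cdot> b}" "e = rplus S c" "f = rstar S c"
      using sigma_action_Some[OF AB(1)] by auto
    \<comment> \<open>Perfectness provides an exact factorisation of \<open>c\<close> with factors
      from the two given classes.\<close>
    then obtain x y where x: "x \<in> sigma S `` {a}" and y: "y \<in> sigma S `` {b}" and cxy: "c = x \<cdot> y"
      using sigma_perfect[OF assms] by blast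
    have xc: "x \<in> carrier S" and yc: "y \<in> carrier S" using x y sigma_carrier by auto
    have p: "rplus S y \<in> proj S" "rstar S x \<in> proj S"
      using xc yc plus_in_proj star_in_proj by auto
    \<comment> \<open>The factors are trimmed so that they match in the middle: the star of
      \<open>?x\<close> and the plus of \<open>?y\<close> are both \<open>x^* y^+\<close>. The plus
      of \<open>?x\<close> and the star of \<open>?y\<close> remain those of
      \<open>c\<close>.\<close>
    let ?x = "x \<cdot> rplus S y" and ?y = "rstar S x \<cdot> y"
    have "?x \<in> sigma S `` {a}" "?y \<in> sigma S `` {b}"
      using class_mult_proj[OF A(1) x p(1)] class_proj_mult[OF B(1) y p(2)] .
    moreover have "rstar S ?x = rplus S ?y"
      using p xc yc by (simp add: star_mult_proj plus_proj_mult)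
    moreover have "rplus S c = rplus S ?x" "rstar S c = rstar S ?y"
      unfolding cxy using xc yc plus_mult star_mult by blast+
    ultimately show "(sigma_action S (sigma S `` {b}) \<circ>\<^sub>m sigma_action S (sigma S `` {a})) e = Some f"
      unfolding map_comp_Some_iff sigma_action_Some[OF A(1)] sigma_action_Some[OF B(1)]
      using c(2,3) by metis
  next
    assume "(sigma_action S (sigma S `` {b}) \<circ>\<^sub>m sigma_action S (sigma S `` {a})) e = Some f"
    then obtain x y where x: "x \<in> sigma S `` {a}" "e = rplus S x" and y: "y \<in> sigma S `` {b}" "f = rstar S y"
      and xy: "rstar S x = rplus S y"
      unfolding map_comp_Some_iff sigma_action_Some[OF A(1)] sigma_action_Some[OF B(1)] by auto
    have xc: "x \<in> carrier S" and yc: "y \<in> carrier S" using x y sigma_carrier by auto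
    \<comment> \<open>When \<open>x^* = y^+\<close>, the plus of \<open>x y\<close> is that of
      \<open>x x^* = x\<close>; dually its star is that of \<open>y^+ y = y\<close>.\<close>
    have "rplus S (x \<cdot> y) = e" using plus_mult[OF xc yc] xy x star_right[OF xc] by simp
    moreover have "rstar S (x \<cdot> y) = f" using star_mult[OF xc yc] xy y plus_left[OF yc] by simp
    moreover have "x \<cdot> y \<in> sigma S `` {a \<cdot> b}" using x y sigma_mult by simp
    ultimately show "sigma_action S (sigma S `` {a \<cdot> b}) e = Some f"
      unfolding sigma_action_Some[OF AB(1)] by metis
  qed
  then show ?thesis by (intro ext) (metis option.exhaust)
qed

lemma sigma_action_one: "sigma_action S (proj S) = \<one>\<^bsub>TI (proj_semilattice S)\<^esub>"
proof
  interpret Y: semilattice_algebra "proj_semilattice S" by (rule semilattice_proj)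
  fix e
  obtain f where "f \<in> proj S" using nonempty plus_in_proj by blast
  then have P: "proj S \<in> carrier S // sigma S"
    using sigma_class(1)[OF proj_carrier] proj_class by metis
  show "sigma_action S (proj S) e = \<one>\<^bsub>TI (proj_semilattice S)\<^esub> e"
  proof (cases "e \<in> proj S")
    case True
    then have "sigma_action S (proj S) e = Some e"
      unfolding sigma_action_Some[OF P] by (metis proj_plus proj_star)
    then show ?thesis using True by (simp add: Y.TI_one)
  next
    case False
    then have "sigma_action S (proj S) e \<noteq> Some x" for x
      unfolding sigma_action_Some[OF P] by (auto simp: proj_plus)
    then show ?thesis using False by (auto simp: Y.TI_one)
  qed
qed

section \<open>The isomorphism of an almost perfect semigroup with \<open>W\<close>\<close>

context
  fixes \<alpha> assumes \<alpha>: "\<And>C. C \<in> carrier S // sigma S \<Longrightarrow> \<alpha> C = sigma_action S C"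
begin

text \<open>Stated for any \<alpha> agreeing with \<open>sigma_action\<close> on classes, so that it
  covers both \<open>sigma_action\<close> itself and \<open>munn_action\<close>.\<close>

lemma acts_sigma_action: "acts_by_ideal_isos (sigma_quotient S) (proj_semilattice S) \<alpha>"
proof -
  interpret Y: semilattice_algebra "proj_semilattice S" by (rule semilattice_proj)
  interpret Q: monoid "sigma_quotient S" by (rule monoid_sigma_quotient)
  have "\<alpha> (A \<otimes>\<^bsub>sigma_quotient S\<^esub> B) = \<alpha> A \<otimes>\<^bsub>TI (proj_semilattice S)\<^esub> \<alpha> B"
    if AB: "A \<in> carrier (sigma_quotient S)" "B \<in> carrier (sigma_quotient S)" for A B
  proof -
    obtain a where a: "a \<in> carrier S" "A = sigma S `` {a}" using AB(1) by (rule class_cases)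
    obtain b where b: "b \<in> carrier S" "B = sigma S `` {b}" using AB(2) by (rule class_cases)
    show ?thesis
      using a b by (simp add: sigma_quotient_mult \<alpha> sigma_class closed sigma_action_mult Y.TI_mult)
  qed
  moreover have "\<alpha> \<one>\<^bsub>sigma_quotient S\<^esub> = \<one>\<^bsub>TI (proj_semilattice S)\<^esub>"
    using \<alpha>[OF Q.one_closed[unfolded sigma_quotient_carrier]]
    by (simp add: sigma_quotient_one sigma_action_one)
  ultimately show ?thesis
    by (auto simp: acts_by_ideal_isos_def hom_def sigma_quotient_carrier \<alpha> sigma_action_in_TI)
qed

lemma restr_iso_W: "restr_iso S (W (sigma_quotient S) (proj_semilattice S) \<alpha>)"
proof -
  interpret A: ideal_action "sigma_quotient S" "proj_semilattice S" \<alpha>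
    by (simp add: ideal_action_def ideal_action_axioms_def monoid_sigma_quotient semilattice_proj
        acts_sigma_action)
  let ?h = "\<lambda>a. (sigma S `` {a}, rstar S a)"
  have act: "rplus S a \<in> dom (\<alpha> (sigma S `` {b})) \<and>
      act \<alpha> (sigma S `` {b}) (rplus S a) = rstar S a"
    if "b \<in> carrier S" "a \<in> sigma S `` {b}" for a b
  proof -
    have "\<alpha> (sigma S `` {b}) (rplus S a) = Some (rstar S a)"
      using that sigma_class[OF that(1)] sigma_action_Some by (auto simp: \<alpha>)
    then show ?thesis by (auto simp: act_def)
  qed
  have h: "?h a = (sigma S `` {a}, act \<alpha> (sigma S `` {a}) (rplus S a))"
    and dom: "rplus S a \<in> dom (\<alpha> (sigma S `` {a}))"
    and cl: "sigma S `` {a} \<in> carrier (sigma_quotient S)" if "a \<in> carrier S" for a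
    using that act sigma_class sigma_quotient_carrier by auto
  have h_closed: "?h a \<in> carrier A.W'" if "a \<in> carrier S" for a
    using A.W_carrierI[OF cl dom] h that by simp
  have "?h (a \<cdot> b) = ?h a \<cdot>\<^bsub>A.W'\<^esub> ?h b" if a: "a \<in> carrier S" and b: "b \<in> carrier S" for a b
  proof -
    have p: "rstar S a \<in> proj S" using a star_in_proj by simp
    \<comment> \<open>The element \<open>a^* b\<close> stays in the class of \<open>b\<close>, has
      plus \<open>a^* b^+\<close> and the same star as \<open>a b\<close>. Its point on the graph is
      exactly the product formula of \<open>W\<close>.\<close>
    have "rstar S a \<cdot> b \<in> sigma S `` {b}"
      using class_proj_mult[OF sigma_class(1)[OF b] sigma_class(2)[OF b] p] .
    then have "act \<alpha> (sigma S `` {b}) (rplus S (rstar S a \<cdot> b)) = rstar S (rstar S a \<cdot> b)"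
      using act b by blast
    then have "act \<alpha> (sigma S `` {b}) (rstar S a \<cdot> rplus S b) = rstar S (a \<cdot> b)"
      using a b p by (simp add: plus_proj_mult star_mult[symmetric])
    then show ?thesis
      unfolding h[OF b] A.W_mult'[OF cl[OF b] dom[OF b]] using a b
      by (simp add: sigma_quotient_mult)
  qed
  moreover have "?h (rplus S a) = rplus A.W' (?h a)" "?h (rstar S a) = rstar A.W' (?h a)"
    if a: "a \<in> carrier S" for a
  proof -
    have p: "rplus S a \<in> proj S" "rstar S a \<in> proj S" using a plus_in_proj star_in_proj by auto
    show "?h (rplus S a) = rplus A.W' (?h a)"
      unfolding h[OF a] A.W_plus'[OF cl[OF a] dom[OF a]]
      using p by (simp add: sigma_quotient_one proj_class proj_star)
    show "?h (rstar S a) = rstar A.W' (?h a)"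
      using p by (simp add: W_star sigma_quotient_one proj_class proj_star)
  qed
  moreover have "bij_betw ?h (carrier S) (carrier A.W')"
  proof (rule bij_betw_imageI)
    show "inj_on ?h (carrier S)"
    proof (rule inj_onI)
      fix a b assume a: "a \<in> carrier S" and "b \<in> carrier S" and eq: "?h a = ?h b"
      then have "b \<in> sigma S `` {a}" using sigma_class by simp
      \<comment> \<open>Equal images mean the same class and the same star, so this is properness
        again.\<close>
      then show "a = b" using eq sigma_star_eq[of a b] by auto
    qed
    show "?h ` carrier S = carrier A.W'"
    proof
      show "?h ` carrier S \<subseteq> carrier A.W'" using h_closed by blast
      show "carrier A.W' \<subseteq> ?h ` carrier S"
      proof
        fix x assume "x \<in> carrier A.W'"
        then obtain C e where x: "x = (C, act \<alpha> C e)" and C: "C \<in> carrier S // sigma S"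
          and "e \<in> dom (\<alpha> C)"
          using A.W_cases unfolding sigma_quotient_carrier by blast
        then obtain f where "sigma_action S C e = Some f" by (auto simp: \<alpha>)
        \<comment> \<open>A point of the graph of the class comes from an element \<open>a\<close>
          of that class, and this \<open>a\<close> is the required preimage.\<close>
        then obtain a where a: "a \<in> C" "e = rplus S a" using sigma_action_Some[OF C] by blast
        then have "x = ?h a"
          using x class_eq[OF C a(1)] class_carrier[OF C a(1)] h by simp
        then show "x \<in> ?h ` carrier S" using class_carrier[OF C a(1)] by blast
      qed
    qed
  qed
  ultimately show ?thesis unfolding restr_iso_def restr_hom_def using h_closed by blast
qed

end

text \<open>An element \<open>a = g m\<close> of \<open>C\<close> has \<open>a^+ = g m^+\<close>,
  which lies below \<open>m^+\<close>. Then \<open>a^+ m\<close> and \<open>a\<close> have the same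
  plus in one class and coincide, so \<open>C\<close> consists of the restrictions of
  \<open>m\<close>.\<close>

lemma munn_greatest:
  assumes C: "C \<in> carrier S // sigma S" and m: "is_greatest S C m"
  shows "munn S m = sigma_action S C"
proof -
  have mC: "m \<in> C" using m by (simp add: is_greatest_def)
  have mc: "m \<in> carrier S" using class_carrier[OF C mC] .
  have mp: "rplus S m \<in> proj S" using mc plus_in_proj by simp
  have "munn S m e = Some f \<longleftrightarrow> sigma_action S C e = Some f" for e f
    unfolding munn_Some[OF mc] sigma_action_Some[OF C]
  proof
    assume e: "e \<in> proj S \<and> e = e \<cdot> rplus S m \<and> f = rstar S (e \<cdot> m)"
    then have "e \<cdot> m \<in> C" using class_proj_mult[OF C mC] by blast
    moreover have "rplus S (e \<cdot> m) = e" using plus_proj_mult e mc by simp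
    ultimately show "\<exists>a\<in>C. e = rplus S a \<and> f = rstar S a" using e by (metis)
  next
    assume "\<exists>a\<in>C. e = rplus S a \<and> f = rstar S a"
    then obtain a where a: "a \<in> C" "e = rplus S a" "f = rstar S a" by blast
    then have "natural_le S a m" using m by (simp add: is_greatest_def)
    then obtain g where g: "g \<in> proj S" "a = g \<cdot> m" by (auto simp: natural_le_def)
    have ep: "e \<in> proj S" using a class_carrier[OF C] plus_in_proj by simp
    have "e = g \<cdot> rplus S m" using a(2) g plus_proj_mult mc by simp
    then have e: "e \<cdot> rplus S m = e" using g(1) mp by (metis assoc proj_carrier proj_idem)
    then have "rplus S (e \<cdot> m) = rplus S a" using a(2) ep mc plus_proj_mult by simp
    then have "e \<cdot> m = a"
      using class_plus_eq[OF C class_proj_mult[OF C mC ep] a(1)] by blast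
    then show "e \<in> proj S \<and> e = e \<cdot> rplus S m \<and> f = rstar S (e \<cdot> m)"
      using a ep e by simp
  qed
  then show ?thesis by (intro ext) (metis option.exhaust)
qed

lemma is_greatest_greatest_of:
  assumes C: "C \<in> carrier S // sigma S" and m: "is_greatest S C m"
  shows "greatest_of S C = m"
  unfolding greatest_of_def
proof (rule the_equality)
  fix k assume "is_greatest S C k"
  then show "k = m"
    using m class_carrier[OF C] by (intro natural_le_antisym) (auto simp: is_greatest_def)
qed (rule m)

end

theorem theorem1p1:
  shows "
    (\<forall>U :: 'a restr. restriction_semigroup U \<longrightarrow>
       (\<exists>S :: ('a list \<times> 'a) restr. almost_perfect S \<and> is_cover S U)) \<and>
    (\<forall>(T :: 't monoid) (Y :: 'y magma) \<alpha>.
       monoid T \<and> semilattice_algebra Y \<and> acts_by_ideal_isos T Y \<alpha> \<longrightarrow>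
       almost_perfect (W T Y \<alpha>)) \<and>
    (\<forall>S :: 'a restr. almost_perfect S \<longrightarrow>
       (\<exists>(T :: 'a set monoid) (Y :: 'a magma) \<alpha>.
          monoid T \<and> semilattice_algebra Y \<and> acts_by_ideal_isos T Y \<alpha> \<and>
          restr_iso S (W T Y \<alpha>))) \<and>
    (\<forall>U :: 'a restr. restriction_monoid U \<longrightarrow>
       (\<exists>S :: ('a list \<times> 'a) restr. perfect S \<and> is_monoidal_cover S U)) \<and>
    (\<forall>(T :: 't monoid) (Y :: 'y magma) \<alpha>.
       monoid T \<and> semilattice_algebra Y \<and> has_identity Y \<and>
       acts_by_principal_ideal_isos T Y \<alpha> \<longrightarrow>
       perfect (W T Y \<alpha>)) \<and>
    (\<forall>M :: 'a restr. perfect M \<longrightarrow>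
       monoid (sigma_quotient M) \<and>
       semilattice_algebra (proj_semilattice M) \<and> has_identity (proj_semilattice M) \<and>
       acts_by_principal_ideal_isos (sigma_quotient M) (proj_semilattice M) (munn_action M) \<and>
       restr_iso M (W (sigma_quotient M) (proj_semilattice M) (munn_action M)))"
proof (intro conjI allI impI)
  fix U :: "'a restr" assume "restriction_semigroup U"
  then show "\<exists>S :: ('a list \<times> 'a) restr. almost_perfect S \<and> is_cover S U"
    using restriction_semigroup.almost_perfect_cover by blast
next
  fix T :: "'t monoid" and Y :: "'y magma" and \<alpha>
  assume "monoid T \<and> semilattice_algebra Y \<and> acts_by_ideal_isos T Y \<alpha>"
  then show "almost_perfect (W T Y \<alpha>)"
    by (intro ideal_action.almost_perfect_W) (simp add: ideal_action_def ideal_action_axioms_def)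
next
  fix S :: "'a restr" assume "almost_perfect S"
  then interpret almost_perfect_semigroup S
    by (simp add: almost_perfect_semigroup_def almost_perfect_semigroup_axioms_def
        almost_perfect_def proper_def)
  show "\<exists>(T :: 'a set monoid) (Y :: 'a magma) \<alpha>.
      monoid T \<and> semilattice_algebra Y \<and> acts_by_ideal_isos T Y \<alpha> \<and> restr_iso S (W T Y \<alpha>)"
    \<comment> \<open>The witnesses are \<open>sigma_quotient S\<close>,
      \<open>proj_semilattice S\<close> and \<open>sigma_action S\<close>.\<close>
    using monoid_sigma_quotient semilattice_proj acts_sigma_action restr_iso_W by blast
next
  fix U :: "'a restr" assume "restriction_monoid U"
  then show "\<exists>S :: ('a list \<times> 'a) restr. perfect S \<and> is_monoidal_cover S U"
    unfolding restriction_monoid_def using restriction_semigroup.perfect_monoidal_cover by blast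
next
  fix T :: "'t monoid" and Y :: "'y magma" and \<alpha>
  assume "monoid T \<and> semilattice_algebra Y \<and> has_identity Y \<and> acts_by_principal_ideal_isos T Y \<alpha>"
  then show "perfect (W T Y \<alpha>)"
    by (intro ideal_action.perfect_W)
      (simp_all add: ideal_action_def ideal_action_axioms_def acts_by_principal_ideal_isos_def)
next
  fix M :: "'a restr" assume M: "perfect M"
  then interpret almost_perfect_semigroup M
    by (simp add: almost_perfect_semigroup_def almost_perfect_semigroup_axioms_def
        almost_perfect_def proper_def perfect_def)
  \<comment> \<open>Perfection gives each class a greatest element. So \<open>munn_action\<close>
    agrees with \<open>sigma_action\<close> on classes and inherits the homomorphism and isomorphism
    results, while its values are Munn isomorphisms and hence principal.\<close>
  have action: "munn_action M C = sigma_action M C"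
    and principal: "munn_action M C \<in> munn_semigroup (proj_semilattice M)"
    if C: "C \<in> carrier M // sigma M" for C
  proof -
    obtain m where m: "is_greatest M C m" using M C by (auto simp: perfect_def)
    then have "m \<in> carrier M" using class_carrier[OF C] by (simp add: is_greatest_def)
    then show "munn_action M C = sigma_action M C"
      "munn_action M C \<in> munn_semigroup (proj_semilattice M)"
      using is_greatest_greatest_of[OF C m] munn_greatest[OF C m] munn_in_munn_semigroup[of m]
      by (simp_all add: munn_action_def)
  qed
  show "monoid (sigma_quotient M)" by (rule monoid_sigma_quotient)
  show "semilattice_algebra (proj_semilattice M)" by (rule semilattice_proj)
  show "has_identity (proj_semilattice M)"
    using M has_identity_proj by (simp add: perfect_def restriction_monoid_def)
  show "acts_by_principal_ideal_isos (sigma_quotient M) (proj_semilattice M) (munn_action M)"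
    using acts_sigma_action[OF action] principal
    by (simp add: acts_by_principal_ideal_isos_def sigma_quotient_carrier)
  show "restr_iso M (W (sigma_quotient M) (proj_semilattice M) (munn_action M))"
    using action by (rule restr_iso_W)
qed

end
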